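(* Let $n\ge2$. Suppose $\Omega\in L\log L(S^{n-1})$ is positively homogeneous of degree $0$, $\int_{S^{n-1}}\Omega(\theta)\,d\theta=0$, $h\in\mathcal H(1)$, and $$\int_0^1|h(t)-h(0)|\,\frac{dt}t<\infty .$$ For $f\in C_0^1(\mathbb R^n)$ let $$Tf(x)=\mathrm{p.v.}\int_{\mathbb R^n}\frac{\Omega(x-y)}{|x-y|^n}\,h(|x-y|)\,f(y)\,dy$$ and, for $t>0$, $$A_tf(x)=\frac1{t^n}\int_{tS}h(|y|)\,f(x-y)\,\operatorname{sgn}\Omega(y)\,dy,$$ where $S=S_\Omega$ is the star-shaped set associated with $\Omega$. Then the integral $\int_0^\infty A_tf(x)\,t^{-1}\,dt$ converges absolutely and $$Tf(x)=n\int_0^\infty A_tf(x)\,\frac{dt}t+h(0)\,c_\Omega\,f(x)$$ for all $x\in\mathbb R^n$ and all $f\in C_0^1(\mathbb R^n)$, where $c_\Omega=\frac1n\int_{S^{n-1}}\Omega(\theta)\log|\Omega(\theta)|\,d\theta$.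
   Context: $S^{n-1}$ is the unit sphere of $\mathbb R^n$ with surface measure $d\theta$; functions positively homogeneous of degree $0$ are identified with their restrictions to $S^{n-1}$. $\Omega\in L\log L(S^{n-1})$ means $\int_{S^{n-1}}|\Omega|(1+\log^+|\Omega|)\,d\theta<\infty$; $\Omega\log|\Omega|$ is $0$ where $\Omega=0$. For $z\in\mathbb C$, $\operatorname{sgn}z=z/|z|$ if $z\neq0$ and $\operatorname{sgn}0=0$. $C_0^1(\mathbb R^n)$ is the space of compactly supported $C^1$ functions. $\mathcal H(1)$ is the class of measurable complex-valued functions $h$ on the positive half-line for which there is $C_h>0$ with $\int_R^{2R}|h(r)|\,dr\le C_hR$ for all $R>0$; here $h$ also has a value $h(0)\in\mathbb C$ at $0$. The principal value is $\lim_{\epsilon\to0^+}\int_{|x-y|>\epsilon}$, which exists for every $x$ under these hypotheses. The star-shaped set associated with $\Omega$ is $S_\Omega=\{x\in\mathbb R^n:|x|\le|\Omega(x)|^{1/n}\}$; $tS=\{tx:x\in S\}$. *)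

theory Defs
  imports "HOL-Analysis.Analysis"
begin

(* Surface measure via polar coordinates: \<sigma>(A) is n times the Lebesgue measure of the
   truncated cone {r \<theta> | 0 < r \<le> 1, \<theta> \<in> A} over A, i.e. of the set of points of the punctured
   unit ball whose radial projection sgn y = y / |y| lies in A; see emeasure_surface_measure. *)
definition surface_measure :: "'a::euclidean_space measure" where
  "surface_measure =
     completion
       (scale_measure (of_nat DIM('a))
         (distr (restrict_space lborel (cball 0 1 - {0}))
                (restrict_space borel (sphere 0 1)) sgn))"

lemma emeasure_surface_measure:
  fixes A :: "'a::euclidean_space set"
  assumes A: "A \<in> sets borel" "A \<subseteq> sphere 0 1"
  shows "emeasure surface_measure A =
           of_nat DIM('a) * emeasure lborel {r *\<^sub>R \<theta> |r \<theta>. 0 < r \<and> r \<le> 1 \<and> \<theta> \<in> A}"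
proof -
  let ?B = "cball 0 1 - {0 :: 'a}" and ?S = "sphere 0 1 :: 'a set"
  have meas: "sgn \<in> restrict_space lborel ?B \<rightarrow>\<^sub>M restrict_space borel ?S"
  proof (rule measurable_restrict_space2)
    show "sgn \<in> space (restrict_space lborel ?B) \<rightarrow> ?S"
      by (auto simp: space_restrict_space norm_sgn)
    show "sgn \<in> borel_measurable (restrict_space lborel ?B)"
      by (rule measurable_restrict_space1) (simp add: sgn_div_norm[abs_def])
  qed
  have A': "A \<in> sets (restrict_space borel ?S)"
    using A by (auto simp: sets_restrict_space image_iff)
  have "sgn -` A \<inter> ?B = {r *\<^sub>R \<theta> |r \<theta>. 0 < r \<and> r \<le> 1 \<and> \<theta> \<in> A}" (is "_ = ?C")
  proof (intro equalityI subsetI)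
    fix y assume "y \<in> sgn -` A \<inter> ?B"
    then have "y = norm y *\<^sub>R sgn y" "0 < norm y" "norm y \<le> 1" "sgn y \<in> A"
      by (auto simp: sgn_div_norm)
    then show "y \<in> ?C" by blast
  next
    fix y assume "y \<in> ?C"
    then obtain r \<theta> where "y = r *\<^sub>R \<theta>" "0 < r" "r \<le> 1" "\<theta> \<in> A" by blast
    moreover have "norm \<theta> = 1" using \<open>\<theta> \<in> A\<close> A(2) by auto
    ultimately show "y \<in> sgn -` A \<inter> ?B" by (auto simp: sgn_scaleR sgn_div_norm)
  qed
  moreover from this have "?C \<subseteq> ?B" by blast
  then have "emeasure (restrict_space lborel ?B) ?C = emeasure lborel ?C"
    by (intro emeasure_restrict_space) simp_all
  ultimately show ?thesis
    using A' meas by (simp add: surface_measure_def emeasure_distr space_restrict_space)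
qed

definition log_plus :: "real \<Rightarrow> real" where
  "log_plus s = max 0 (ln s)"

definition L_log_L_sphere :: "('a::euclidean_space \<Rightarrow> complex) set" where
  "L_log_L_sphere =
     {\<Omega>. \<Omega> \<in> borel_measurable surface_measure \<and>
        (\<integral>\<^sup>+\<theta>. ennreal (norm (\<Omega> \<theta>) * (1 + log_plus (norm (\<Omega> \<theta>)))) \<partial>surface_measure) < \<infinity>}"

definition homogeneous_degree_0 :: "('a::euclidean_space \<Rightarrow> complex) \<Rightarrow> bool" where
  "homogeneous_degree_0 \<Omega> \<longleftrightarrow> (\<forall>r>0. \<forall>y. y \<noteq> 0 \<longrightarrow> \<Omega> (r *\<^sub>R y) = \<Omega> y)"

definition class_H1 :: "(real \<Rightarrow> complex) set" where
  "class_H1 =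
     {h. h \<in> borel_measurable (lebesgue_on {0<..}) \<and>
        (\<exists>C>0. \<forall>R>0. (\<integral>\<^sup>+r\<in>{R..2 * R}. ennreal (norm (h r)) \<partial>lebesgue) \<le> ennreal (C * R))}"

definition C1_compact_support :: "('a::euclidean_space \<Rightarrow> complex) set" where
  "C1_compact_support =
     {f. (\<exists>f' :: 'a \<Rightarrow> 'a \<Rightarrow>\<^sub>L complex.
            (\<forall>x. (f has_derivative blinfun_apply (f' x)) (at x)) \<and> continuous_on UNIV f') \<and>
        compact (closure {x. f x \<noteq> 0})}"

definition kernel_integrand ::
    "('a::euclidean_space \<Rightarrow> complex) \<Rightarrow> (real \<Rightarrow> complex) \<Rightarrow> ('a \<Rightarrow> complex) \<Rightarrow> 'a \<Rightarrow> 'a \<Rightarrow> complex" where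
  "kernel_integrand \<Omega> h f x y =
     \<Omega> (x - y) / of_real (norm (x - y) ^ DIM('a)) * h (norm (x - y)) * f y"

definition truncated_op ::
    "('a::euclidean_space \<Rightarrow> complex) \<Rightarrow> (real \<Rightarrow> complex) \<Rightarrow> real \<Rightarrow> ('a \<Rightarrow> complex) \<Rightarrow> 'a \<Rightarrow> complex" where
  "truncated_op \<Omega> h \<epsilon> f x = (LINT y:{y. norm (x - y) > \<epsilon>}|lebesgue. kernel_integrand \<Omega> h f x y)"

definition singular_op ::
    "('a::euclidean_space \<Rightarrow> complex) \<Rightarrow> (real \<Rightarrow> complex) \<Rightarrow> ('a \<Rightarrow> complex) \<Rightarrow> 'a \<Rightarrow> complex" where
  "singular_op \<Omega> h f x = Lim (at_right 0) (\<lambda>\<epsilon>. truncated_op \<Omega> h \<epsilon> f x)"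

definition star_set :: "('a::euclidean_space \<Rightarrow> complex) \<Rightarrow> 'a set" where
  "star_set \<Omega> = {x. norm x \<le> norm (\<Omega> x) powr (1 / real DIM('a))}"

definition average_integrand ::
    "('a::euclidean_space \<Rightarrow> complex) \<Rightarrow> (real \<Rightarrow> complex) \<Rightarrow> ('a \<Rightarrow> complex) \<Rightarrow> 'a \<Rightarrow> 'a \<Rightarrow> complex" where
  "average_integrand \<Omega> h f x y = h (norm y) * f (x - y) * sgn (\<Omega> y)"

definition star_average ::
    "('a::euclidean_space \<Rightarrow> complex) \<Rightarrow> (real \<Rightarrow> complex) \<Rightarrow> real \<Rightarrow> ('a \<Rightarrow> complex) \<Rightarrow> 'a \<Rightarrow> complex" where
  "star_average \<Omega> h t f x =
     1 / of_real (t ^ DIM('a)) *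
     (LINT y:(*\<^sub>R) t ` star_set \<Omega>|lebesgue. average_integrand \<Omega> h f x y)"

(* HOL has 0 * ln 0 = 0, which is the required value where \<Omega> vanishes. *)
definition log_constant :: "('a::euclidean_space \<Rightarrow> complex) \<Rightarrow> complex" where
  "log_constant \<Omega> =
     1 / of_nat DIM('a) * (\<integral>\<theta>. \<Omega> \<theta> * of_real (ln (norm (\<Omega> \<theta>))) \<partial>surface_measure)"

end

(* Write g(y) = f(x - y) and split h(|y|) g(y) = G(y) + h(0) g(0) 1(|y| \<le> 1). The function G \<Omega> / |y|^n is
   absolutely integrable (Lipschitz bound on g, growth bound on h and Dini condition at 0), so the mean
   value zero of \<Omega> gives Tf(x) as its integral, while integrating 1/t^(n+1) over {t. y \<in> tS} produces
   |\<Omega>(y)| / (n |y|^n), so that Fubini identifies the G-part of n \<integral> A_t f dt/t with Tf(x).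
   For the remaining constant part, A_t(1(|y| \<le> 1)) = (1/n) \<integral> min(|\<Omega>|, t^-n) sgn \<Omega> d\<theta>; subtracting the
   vanishing integral of \<Omega> for t \<le> 1 makes the integrand absolutely integrable in (\<theta>, t) with respect to
   dt/t, and the t-integral is (|\<Omega>| - |\<Omega>| log |\<Omega>|) / n. This is where c_\<Omega> comes from. *)
theory Submission
  imports Defs
begin

section \<open>Surface measure on the Borel sets\<close>

text \<open>\<open>\<Omega>\<close> is measurable only for a completed measure and \<open>h\<close>
  only for Lebesgue measure, while Fubini and polar coordinates are applied to functions that are
  Borel on a product. The analysis is therefore done for Borel representatives. The way back to the
  given data rests on polar coordinates: a null set of directions spans a null cone, and a null set
  of radii a null union of spheres. The value h(0) does not survive a change on a null set, so it is
  carried as a separate constant. The two parts of the splitting need different tools. For the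
  G-part the weight |y|^-n becomes dr/r in polar coordinates; the factor |y| of the Lipschitz bound
  removes the 1/r, and the Dini condition, whose radius 1 is that of the cutoff, handles what is
  left. For the constant part the obstacle is t near 0: there min(|\<Omega>|, t^-n) sgn \<Omega> is
  \<Omega> itself once t^n |\<Omega>| \<le> 1, and dt/t diverges. After the subtraction, the
  t-integral of the absolute value is at most (|\<Omega>| + |\<Omega> log|\<Omega>||)/n, which the L
  log L hypothesis makes integrable over the sphere.\<close>

definition sphere_premeasure :: "'a::euclidean_space measure" where
  "sphere_premeasure =
     scale_measure (of_nat DIM('a))
       (distr (restrict_space lborel (cball 0 1 - {0})) (restrict_space borel (sphere 0 1)) sgn)"

lemma surface_measure_eq_completion: "surface_measure = completion sphere_premeasure"
  by (simp add: surface_measure_def sphere_premeasure_def)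

lemma space_sphere_premeasure: "space sphere_premeasure = sphere 0 1"
  by (simp add: sphere_premeasure_def space_scale_measure space_restrict_space)

lemma sets_sphere_premeasure [measurable_cong]:
  "sets sphere_premeasure = sets (restrict_space borel (sphere 0 1))"
  by (simp add: sphere_premeasure_def)

text \<open>The surface measure moved to the Borel sets of the whole space (null off the sphere), so that
  integrands need not be restricted to the sphere.\<close>

definition sphere_measure :: "'a::euclidean_space measure" where
  "sphere_measure = distr sphere_premeasure borel (\<lambda>\<theta>. \<theta>)"

lemma sets_sphere_measure [simp, measurable_cong]: "sets sphere_measure = sets borel"
  and space_sphere_measure [simp]: "space sphere_measure = UNIV"
  by (simp_all add: sphere_measure_def)

lemma measurable_ident_sphere_premeasure: "(\<lambda>\<theta>. \<theta>) \<in> sphere_premeasure \<rightarrow>\<^sub>M borel"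
  unfolding measurable_cong_sets[OF sets_sphere_premeasure refl]
  by (intro measurable_restrict_space1) simp

lemma borel_measurable_sgn [measurable]: "(sgn :: 'a::euclidean_space \<Rightarrow> 'a) \<in> borel_measurable borel"
  by (simp add: sgn_div_norm[abs_def])

text \<open>For \<open>y \<noteq> 0\<close> the direction \<open>sgn y\<close> is on the sphere, so
  the cone formula extends to Borel sets \<open>A\<close> not contained in the sphere.\<close>

lemma emeasure_sphere_measure:
  fixes A :: "'a::euclidean_space set"
  assumes [measurable]: "A \<in> sets borel"
  shows "emeasure sphere_measure A =
    of_nat DIM('a) * emeasure lborel {y. y \<noteq> 0 \<and> norm y \<le> 1 \<and> sgn y \<in> A}"
proof -
  let ?B = "cball 0 1 - {0 :: 'a}"
  have sets: "A \<inter> sphere 0 1 \<in> sets (restrict_space borel (sphere 0 1))"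
    by (auto simp: sets_restrict_space image_iff)
  have meas: "sgn \<in> restrict_space lborel ?B \<rightarrow>\<^sub>M restrict_space borel (sphere 0 1)"
    by (rule measurable_restrict_space2, force simp: space_restrict_space norm_sgn)
       (rule measurable_restrict_space1, simp)
  have "sgn -` (A \<inter> sphere 0 1) \<inter> ?B = {y. y \<noteq> 0 \<and> norm y \<le> 1 \<and> sgn y \<in> A}"
    by (auto simp: norm_sgn)
  moreover have "emeasure sphere_measure A = emeasure sphere_premeasure (A \<inter> sphere 0 1)"
    unfolding sphere_measure_def using measurable_ident_sphere_premeasure
    by (subst emeasure_distr) (auto simp: space_sphere_premeasure Int_commute)
  moreover have "emeasure (restrict_space lborel ?B) {y. y \<noteq> 0 \<and> norm y \<le> 1 \<and> sgn y \<in> A} =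
      emeasure lborel {y. y \<noteq> 0 \<and> norm y \<le> 1 \<and> sgn y \<in> A}"
    by (rule emeasure_restrict_space) auto
  ultimately show ?thesis
    using sets meas by (simp add: sphere_premeasure_def emeasure_distr space_restrict_space)
qed

lemma finite_measure_sphere_measure: "finite_measure (sphere_measure :: 'a::euclidean_space measure)"
proof
  have "emeasure lborel {y :: 'a. y \<noteq> 0 \<and> norm y \<le> 1 \<and> sgn y \<in> UNIV} \<le> emeasure lborel (cball (0::'a) 1)"
    by (intro emeasure_mono) auto
  also have "\<dots> < \<infinity>"
    using emeasure_bounded_finite[OF bounded_cball] by simp
  finally show "emeasure sphere_measure (space (sphere_measure :: 'a measure)) \<noteq> \<infinity>"
    by (simp add: emeasure_sphere_measure ennreal_mult_eq_top_iff del: UNIV_I)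
qed

text \<open>Supplies the exceptional set as a Borel set of the whole space, the form in which
  \<open>AE_lborel_sgn_notin\<close> turns it into a null cone.\<close>

lemma AE_sphere_measure:
  assumes "AE \<theta> in sphere_premeasure. P \<theta>"
  shows "\<exists>N\<in>sets borel. emeasure sphere_measure N = 0 \<and> (\<forall>\<theta>\<in>sphere 0 1 - N. P \<theta>)"
proof -
  obtain N where N: "{\<theta> \<in> space sphere_premeasure. \<not> P \<theta>} \<subseteq> N" "emeasure sphere_premeasure N = 0"
    "N \<in> sets sphere_premeasure"
    using AE_E[OF assms] by blast
  have NS: "N \<subseteq> sphere 0 1" using sets.sets_into_space[OF N(3)] by (simp add: space_sphere_premeasure)
  have borel: "N \<in> sets borel"
    using N(3) unfolding sets_sphere_premeasure by (subst (asm) sets_restrict_space_iff) auto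
  then have "emeasure sphere_measure N = emeasure sphere_premeasure N"
    unfolding sphere_measure_def using measurable_ident_sphere_premeasure NS
    by (subst emeasure_distr) (auto simp: space_sphere_premeasure Int_absorb2)
  with N borel show ?thesis by (intro bexI[of _ N]) (auto simp: space_sphere_premeasure)
qed

section \<open>Polar coordinates\<close>

text \<open>The radial factor of Lebesgue measure in polar coordinates, extended by zero to the
  nonpositive reals so that no restricted spaces occur.\<close>

definition radial_measure :: "nat \<Rightarrow> real measure" where
  "radial_measure n = density lborel (\<lambda>r. ennreal (indicator {0<..} r * r ^ (n - 1)))"

lemma sets_radial_measure [simp, measurable_cong]: "sets (radial_measure n) = sets borel"
  and space_radial_measure [simp]: "space (radial_measure n) = UNIV"
  by (simp_all add: radial_measure_def)

text \<open>The half-lines generate the Borel sets, so these values determine the measure;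
  \<open>max 0 a\<close> gives 0 for nonpositive \<open>a\<close> because
  \<open>n > 0\<close>.\<close>

lemma emeasure_radial_measure_atMost:
  assumes "n > 0"
  shows "emeasure (radial_measure n) {..a} = ennreal (max 0 a ^ n / n)"
proof -
  let ?f = "\<lambda>r. ennreal (indicator {0<..} r * r ^ (n - 1))"
  have "emeasure (radial_measure n) {..a} = (\<integral>\<^sup>+r. ?f r * indicator {..a} r \<partial>lborel)"
    by (simp add: radial_measure_def emeasure_density)
  also have "\<dots> = (\<integral>\<^sup>+r. ennreal (r ^ (n - 1)) * indicator {0..max 0 a} r \<partial>lborel)"
    by (intro nn_integral_cong_AE, use AE_lborel_singleton[of "0::real"] in eventually_elim)
       (auto simp: indicator_def max_def)
  also have "\<dots> = ennreal (max 0 a ^ n / n - 0 ^ n / n)"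
    using assms
    by (intro nn_integral_FTC_Icc) (auto intro!: derivative_eq_intros)
  finally show ?thesis using assms by (simp add: zero_power)
qed

lemma sigma_finite_measure_radial_measure: "sigma_finite_measure (radial_measure n)"
  unfolding radial_measure_def
  by (subst sigma_finite_measure.sigma_finite_iff_density_finite[OF sigma_finite_lborel]) auto

lemma emeasure_lborel_cone_scale:
  fixes A :: "'a::euclidean_space set"
  assumes [measurable]: "A \<in> sets borel" and a: "a > 0"
  shows "emeasure lborel {y. y \<noteq> 0 \<and> norm y \<le> a \<and> sgn y \<in> A} =
    ennreal (a ^ DIM('a)) * emeasure lborel {y. y \<noteq> 0 \<and> norm y \<le> 1 \<and> sgn y \<in> A}"
proof -
  let ?C = "\<lambda>a. {y. y \<noteq> 0 \<and> norm y \<le> a \<and> sgn y \<in> A}"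
  have "(\<lambda>y. 0 + a *\<^sub>R y) -` ?C a = ?C 1"
    using a by (auto simp: sgn_scaleR field_simps)
  then have "emeasure (distr lborel borel (\<lambda>y. 0 + a *\<^sub>R y)) (?C a) = emeasure lborel (?C 1)"
    by (subst emeasure_distr) auto
  moreover have "emeasure lborel (?C a) =
      emeasure (density (distr lborel borel (\<lambda>y. 0 + a *\<^sub>R y)) (\<lambda>_. \<bar>a\<bar> ^ DIM('a))) (?C a)"
    using a by (subst lborel_affine[of a 0]) auto
  ultimately show ?thesis
    using a by (simp add: emeasure_density_const)
qed

text \<open>A product measure is determined by its values on rectangles \<open>A \<times> B\<close>.
  For fixed \<open>A\<close> both sides are measures in \<open>B\<close>, and it suffices to compare
  them on half-lines, where the dilation law for the volume of a cone gives equality.\<close>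

lemma polar_coordinates:
  "distr lborel (borel \<Otimes>\<^sub>M borel) (\<lambda>y. (sgn y, norm y)) =
     (sphere_measure :: 'a::euclidean_space measure) \<Otimes>\<^sub>M radial_measure DIM('a)"
proof (rule sym, rule pair_measure_eqI)
  interpret S: finite_measure "sphere_measure :: 'a measure" by (rule finite_measure_sphere_measure)
  show "sigma_finite_measure (sphere_measure :: 'a measure)" by unfold_locales
  show "sigma_finite_measure (radial_measure DIM('a))" by (rule sigma_finite_measure_radial_measure)
  show "sets ((sphere_measure :: 'a measure) \<Otimes>\<^sub>M radial_measure DIM('a)) =
      sets (distr lborel (borel \<Otimes>\<^sub>M borel) (\<lambda>y::'a. (sgn y, norm y)))"
    by (simp cong: sets_pair_measure_cong)
next
  fix A :: "'a set" and B :: "real set"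
  assume "A \<in> sets sphere_measure" "B \<in> sets (radial_measure DIM('a))"
  then have [measurable]: "A \<in> sets borel" "B \<in> sets borel" by auto
  have fin: "emeasure sphere_measure A < \<infinity>"
    using finite_measure.emeasure_finite[OF finite_measure_sphere_measure, of A] by (simp add: top.not_eq_extremum)
  let ?R = "restrict_space (lborel :: 'a measure) {y. y \<noteq> 0 \<and> sgn y \<in> A}"
  let ?M = "distr ?R borel norm"
  let ?N = "scale_measure (emeasure sphere_measure A) (radial_measure DIM('a))"
  have norm: "norm \<in> ?R \<rightarrow>\<^sub>M borel"
    by (intro measurable_restrict_space1) simp
  have em: "emeasure ?M X = emeasure lborel {y. y \<noteq> 0 \<and> norm y \<in> X \<and> sgn y \<in> A}"
    if [measurable]: "X \<in> sets borel" for X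
  proof -
    have "emeasure ?M X = emeasure ?R (norm -` X \<inter> {y. y \<noteq> 0 \<and> sgn y \<in> A})"
      using norm by (simp add: emeasure_distr space_restrict_space)
    also have "\<dots> = emeasure lborel (norm -` X \<inter> {y. y \<noteq> 0 \<and> sgn y \<in> A})"
      by (rule emeasure_restrict_space) auto
    finally show ?thesis by (simp add: vimage_def Int_def conj_ac)
  qed
  have "?M = ?N"
  proof (rule measure_eqI_generator_eq[where E="range atMost" and \<Omega>=UNIV and A="\<lambda>i. {..real i}"])
    have eq: "emeasure ?M {..a} = emeasure ?N {..a}" for a
    proof (cases "a > 0")
      case True
      have "ennreal (a ^ DIM('a)) = of_nat DIM('a) * ennreal (a ^ DIM('a) / DIM('a))"
        by (simp add: ennreal_of_nat_eq_real_of_nat flip: ennreal_mult')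
      moreover have "emeasure ?M {..a} = ennreal (a ^ DIM('a)) * emeasure lborel {y. y \<noteq> 0 \<and> norm y \<le> 1 \<and> sgn y \<in> A}"
        using emeasure_lborel_cone_scale[of A a] True by (simp add: em[of "{..a}"])
      moreover have "emeasure ?N {..a} = emeasure sphere_measure A * ennreal (a ^ DIM('a) / DIM('a))"
        using True by (simp add: emeasure_radial_measure_atMost)
      ultimately show ?thesis by (simp add: emeasure_sphere_measure mult_ac)
    next
      case False
      then have "{y. y \<noteq> 0 \<and> norm y \<in> {..a} \<and> sgn y \<in> A} = {}"
        by (auto simp: not_less dest: order_trans)
      then have "emeasure ?M {..a} = 0" by (simp only: em[of "{..a}"] atMost_borel emeasure_empty)
      moreover have "max 0 a = 0" using False by simp
      then have "emeasure ?N {..a} = 0" by (simp add: emeasure_radial_measure_atMost zero_power)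
      ultimately show ?thesis by simp
    qed
    then show "emeasure ?M X = emeasure ?N X" if "X \<in> range atMost" for X using that by auto
    show "emeasure ?M {..real i} \<noteq> \<infinity>" for i
      unfolding eq using fin by (simp add: emeasure_radial_measure_atMost ennreal_mult_eq_top_iff)
    show "(\<Union>i. {..real i}) = UNIV" by (auto simp: real_arch_simple)
  qed (auto simp: Int_stable_def borel_eq_atMost sets_measure_of)
  then have "emeasure ?M B = emeasure ?N B" by simp
  moreover have "emeasure (distr lborel (borel \<Otimes>\<^sub>M borel) (\<lambda>y::'a. (sgn y, norm y))) (A \<times> B) =
      emeasure lborel {y. norm y \<in> B \<and> sgn y \<in> A}"
    by (subst emeasure_distr) (auto intro!: arg_cong[where f="emeasure lborel"])
  \<comment> \<open>Since \<open>sgn 0 = 0\<close> may lie in \<open>A\<close>, the origin has to be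
    removed as a null set.\<close>
  moreover have "\<dots> = emeasure lborel {y. y \<noteq> 0 \<and> norm y \<in> B \<and> sgn y \<in> A}"
    by (intro emeasure_eq_AE, use AE_lborel_singleton[of "0::'a"] in eventually_elim) auto
  ultimately show "emeasure sphere_measure A * emeasure (radial_measure DIM('a)) B =
      emeasure (distr lborel (borel \<Otimes>\<^sub>M borel) (\<lambda>y::'a. (sgn y, norm y))) (A \<times> B)"
    by (simp add: em)
qed

lemma measurable_sphere_measure [simp]: "measurable sphere_measure M = measurable borel M"
  and measurable_radial_measure [simp]: "measurable (radial_measure n) M = measurable borel M"
  by (auto intro!: measurable_cong_sets)

lemma pair_sigma_finite_polar:
  "pair_sigma_finite (sphere_measure :: 'a::euclidean_space measure) (radial_measure n)"
proof -
  interpret S: finite_measure "sphere_measure :: 'a measure" by (rule finite_measure_sphere_measure)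
  interpret R: sigma_finite_measure "radial_measure n" by (rule sigma_finite_measure_radial_measure)
  show ?thesis by unfold_locales
qed

lemma pair_sigma_finite_sphere_lborel:
  "pair_sigma_finite (sphere_measure :: 'a::euclidean_space measure) (lborel :: real measure)"
proof -
  interpret S: finite_measure "sphere_measure :: 'a measure" by (rule finite_measure_sphere_measure)
  show ?thesis by unfold_locales
qed

text \<open>The cone over \<open>N\<close> is the preimage of \<open>N \<times> UNIV\<close>, a
  product with a null factor.\<close>

lemma AE_lborel_sgn_notin:
  fixes N :: "'a::euclidean_space set"
  assumes [measurable]: "N \<in> sets borel" and N: "emeasure sphere_measure N = 0"
  shows "AE y in lborel. sgn y \<notin> N"
proof (rule AE_I)
  interpret sigma_finite_measure "radial_measure DIM('a)" by (rule sigma_finite_measure_radial_measure)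
  have "emeasure lborel {y. sgn y \<in> N} =
      emeasure (distr lborel (borel \<Otimes>\<^sub>M borel) (\<lambda>y::'a. (sgn y, norm y))) (N \<times> UNIV)"
    by (subst emeasure_distr) (auto intro!: arg_cong[where f="emeasure lborel"])
  also have "\<dots> = 0"
    by (simp add: polar_coordinates emeasure_pair_measure_Times N)
  finally show "emeasure lborel {y. sgn y \<in> N} = 0" .
qed auto

text \<open>The radial measure has a density with respect to \<open>lborel\<close>, so a null set of
  radii stays null for it and its preimage is the preimage of a null rectangle.\<close>

lemma AE_lborel_norm:
  assumes "AE r in lborel. P r"
  shows "AE y::'a::euclidean_space in lborel. P (norm y)"
proof -
  interpret sigma_finite_measure "radial_measure DIM('a)" by (rule sigma_finite_measure_radial_measure)
  obtain N where "{r \<in> space lborel. \<not> P r} \<subseteq> N" "emeasure lborel N = 0" "N \<in> sets lborel"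
    using AE_E[OF assms] by blast
  then have N: "{r. \<not> P r} \<subseteq> N" "N \<in> null_sets lborel"
    by (simp_all add: null_sets_def)
  then have [measurable]: "N \<in> sets borel" by auto
  have "AE r in radial_measure DIM('a). r \<notin> N"
    unfolding radial_measure_def
    by (subst AE_density) (use AE_not_in[OF N(2)] in auto)
  then have "emeasure (radial_measure DIM('a)) N = 0"
    by (subst (asm) AE_iff_null_sets[symmetric]) (auto simp: null_sets_def)
  then have "emeasure (distr lborel (borel \<Otimes>\<^sub>M borel) (\<lambda>y::'a. (sgn y, norm y))) (UNIV \<times> N) = 0"
    by (simp add: polar_coordinates emeasure_pair_measure_Times)
  moreover have "emeasure (distr lborel (borel \<Otimes>\<^sub>M borel) (\<lambda>y::'a. (sgn y, norm y))) (UNIV \<times> N) =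
      emeasure lborel {y::'a. norm y \<in> N}"
    by (subst emeasure_distr) (auto intro!: arg_cong[where f="emeasure lborel"])
  ultimately show ?thesis
    using N(1) by (intro AE_I[where N="{y. norm y \<in> N}"]) auto
qed

lemma integrable_polar_iff:
  fixes F :: "'a::euclidean_space \<times> real \<Rightarrow> 'b::{banach, second_countable_topology}"
  assumes "F \<in> borel_measurable (borel \<Otimes>\<^sub>M borel)"
  shows "integrable lborel (\<lambda>y. F (sgn y, norm y)) \<longleftrightarrow>
    integrable (sphere_measure \<Otimes>\<^sub>M radial_measure DIM('a)) F"
  using assms by (subst polar_coordinates[symmetric], subst integrable_distr_eq) auto

lemma integral_polar:
  fixes F :: "'a::euclidean_space \<times> real \<Rightarrow> 'b::{banach, second_countable_topology}"
  assumes F: "F \<in> borel_measurable (borel \<Otimes>\<^sub>M borel)"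
    and int: "integrable lborel (\<lambda>y. F (sgn y, norm y))"
  shows "(\<integral>y. F (sgn y, norm y) \<partial>lborel) = (\<integral>\<theta>. \<integral>r. F (\<theta>, r) \<partial>radial_measure DIM('a) \<partial>sphere_measure)"
proof -
  interpret pair_sigma_finite "sphere_measure :: 'a measure" "radial_measure DIM('a)"
    by (rule pair_sigma_finite_polar)
  have "(\<integral>y. F (sgn y, norm y) \<partial>lborel) = (\<integral>p. F p \<partial>(sphere_measure \<Otimes>\<^sub>M radial_measure DIM('a)))"
    using F by (subst polar_coordinates[symmetric], subst integral_distr) auto
  also have "\<dots> = (\<integral>\<theta>. \<integral>r. F (\<theta>, r) \<partial>radial_measure DIM('a) \<partial>sphere_measure)"
    using integral_fst'[of F] integrable_polar_iff[OF F] int by simp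
  finally show ?thesis .
qed

lemma integrable_radial_measure_iff:
  fixes \<phi> :: "real \<Rightarrow> 'b::{banach, second_countable_topology}"
  assumes "\<phi> \<in> borel_measurable borel"
  shows "integrable (radial_measure n) \<phi> \<longleftrightarrow>
    integrable lborel (\<lambda>r. (indicator {0<..} r * r ^ (n - 1)) *\<^sub>R \<phi> r)"
  unfolding radial_measure_def using assms
  by (intro integrable_density) (auto simp: indicator_def)

text \<open>Turns radial majorants into majorants on the whole space, and lets the mean value zero
  of \<open>\<Omega>\<close> annihilate every integrable radial factor.\<close>

lemma
  fixes \<Omega> :: "'a::euclidean_space \<Rightarrow> complex" and \<phi> :: "real \<Rightarrow> complex"
  assumes \<Omega>: "integrable sphere_measure \<Omega>"
    and \<phi>: "integrable (radial_measure DIM('a)) \<phi>"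
  shows integrable_polar_product: "integrable lborel (\<lambda>y. \<Omega> (sgn y) * \<phi> (norm y))"
    and integral_polar_product: "(\<integral>y. \<Omega> (sgn y) * \<phi> (norm y) \<partial>lborel) =
      (\<integral>\<theta>. \<Omega> \<theta> \<partial>sphere_measure) * (\<integral>r. \<phi> r \<partial>radial_measure DIM('a))"
proof -
  interpret pair_sigma_finite "sphere_measure :: 'a measure" "radial_measure DIM('a)"
    by (rule pair_sigma_finite_polar)
  have [measurable]: "\<Omega> \<in> borel_measurable borel" "\<phi> \<in> borel_measurable borel"
    using borel_measurable_integrable[OF \<Omega>] borel_measurable_integrable[OF \<phi>]
    by simp_all
  let ?F = "\<lambda>(\<theta>, r). \<Omega> \<theta> * \<phi> r"
  have F: "?F \<in> borel_measurable (borel \<Otimes>\<^sub>M borel)" by measurable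
  have "integrable (sphere_measure \<Otimes>\<^sub>M radial_measure DIM('a)) ?F"
    by (rule Fubini_integrable) (use \<Omega> \<phi> in \<open>auto simp: norm_mult\<close>)
  then show *: "integrable lborel (\<lambda>y. \<Omega> (sgn y) * \<phi> (norm y))"
    using integrable_polar_iff[OF F] by simp
  show "(\<integral>y. \<Omega> (sgn y) * \<phi> (norm y) \<partial>lborel) =
      (\<integral>\<theta>. \<Omega> \<theta> \<partial>sphere_measure) * (\<integral>r. \<phi> r \<partial>radial_measure DIM('a))"
    using integral_polar[OF F] * by simp
qed

lemma integral_radial_measure_Ioc:
  assumes "n > 0" "b \<ge> 0"
  shows "(\<integral>r. indicator {0<..b} r *\<^sub>R z \<partial>radial_measure n) = of_real (b ^ n / n) * (z::complex)"
proof -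
  have "emeasure (radial_measure n) {..0} = 0"
    using assms by (simp add: emeasure_radial_measure_atMost zero_power)
  then have null: "{..0} \<in> null_sets (radial_measure n)" by (auto simp: null_sets_def)
  have "{0<..b} = {..b} - {..0::real}" by auto
  then have "emeasure (radial_measure n) {0<..b} = ennreal (b ^ n / n)"
    using emeasure_Diff_null_set[OF null, of "{..b}"] emeasure_radial_measure_atMost[of n b] assms by simp
  moreover from this have "measure (radial_measure n) {0<..b} = b ^ n / n"
    using assms by (simp add: Sigma_Algebra.measure_def)
  ultimately show ?thesis by (simp add: scaleR_conv_of_real)
qed

text \<open>The exponent \<open>n + 1\<close> combines the normalisation \<open>t^-n\<close> of the
  average with \<open>dt/t\<close>; \<open>a\<close> will be the smallest \<open>t\<close> for which
  the dilate by \<open>t\<close> contains a given point.\<close>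

lemma has_bochner_integral_inverse_power_tail:
  assumes "a > 0" "n > 0"
  shows "has_bochner_integral lborel (\<lambda>t. indicator {a..} t / t ^ (n + 1)) (1 / (n * a ^ n) :: real)"
proof -
  let ?F = "\<lambda>t::real. (- 1 / n) * inverse t ^ n"
  have "(\<integral>\<^sup>+t. ennreal (1 / t ^ (n + 1)) * indicator {a..} t \<partial>lborel) = ennreal (0 - ?F a)"
  proof (rule nn_integral_FTC_atLeast)
    show "DERIV ?F t :> 1 / t ^ (n + 1)" if "a \<le> t" for t
    proof -
      have "DERIV ?F t :> (- 1 / n) * (n * inverse t ^ (n - 1) * - (inverse t ^ 2))"
        using that assms by (auto intro!: derivative_eq_intros simp: power2_eq_square)
      moreover have "(- 1 / n) * (n * inverse t ^ (n - 1) * - (inverse t ^ 2)) = inverse t ^ (n - 1 + 2)"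
        using assms by (simp only: power_add) simp
      moreover have "n - 1 + 2 = n + 1" using assms by simp
      ultimately have "DERIV ?F t :> inverse t ^ (n + 1)" by metis
      then show ?thesis by (simp only: inverse_eq_divide power_one_over)
    qed
    show "(?F \<longlongrightarrow> 0) at_top"
      by (intro tendsto_mult_right_zero tendsto_null_power tendsto_inverse_0_at_top filterlim_ident assms)
  qed (use assms in auto)
  also have "(\<integral>\<^sup>+t. ennreal (1 / t ^ (n + 1)) * indicator {a..} t \<partial>lborel) =
      (\<integral>\<^sup>+t. ennreal (indicator {a..} t / t ^ (n + 1)) \<partial>lborel)"
    by (intro nn_integral_cong) (auto simp: indicator_def)
  also have "0 - ?F a = 1 / (n * a ^ n)"
    by (simp add: field_simps)
  finally show ?thesis
    using assms by (intro has_bochner_integral_nn_integral) (auto simp: indicator_def)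
qed

section \<open>The truncation kernel\<close>

lemma has_bochner_integral_inverse_Icc:
  assumes "0 < a" "a \<le> b"
  shows "has_bochner_integral lborel (\<lambda>t. indicator {a..b} t / t) (ln b - ln a :: real)"
proof -
  have "has_bochner_integral lborel (\<lambda>t. 1 / t * indicator {a..b} t) (ln b - ln a)"
    using assms
    by (intro has_bochner_integral_FTC_Icc_nonneg) (auto intro!: derivative_eq_intros)
  then show ?thesis by (simp add: mult.commute)
qed

text \<open>Here \<open>w\<close> stands for |\<Omega>(\<theta>)|. Let
  \<open>a = w powr (-1/n)\<close>, the point where \<open>1/t^n = w\<close>. From \<open>a\<close>
  on, the minimum is \<open>1/t^n\<close> and contributes \<open>w/n\<close>. Before
  \<open>a\<close> it is \<open>w\<close>, which the subtracted term cancels up to 1. The mismatch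
  between \<open>a\<close> and 1 is \<open>w/t\<close> if \<open>a > 1\<close> and
  \<open>-w/t\<close> if \<open>a < 1\<close>; in both cases it contributes
  \<open>w * ln a = - w * ln w / n\<close>. The bound on the norm adds the two contributions in
  absolute value.\<close>

lemma
  fixes w :: real
  assumes "w \<ge> 0" "n > 0"
  defines "K \<equiv> \<lambda>t. indicator {0<..} t * (min w (1 / t ^ n) - w * indicator {..1} t) / t"
  shows integrable_truncation_kernel: "integrable lborel K"
    and integral_truncation_kernel: "integral\<^sup>L lborel K = (w - w * ln w) / n"
    and integral_norm_truncation_kernel: "(\<integral>t. norm (K t) \<partial>lborel) \<le> (w + norm (w * ln w)) / n"
proof -
  have "integrable lborel K \<and> integral\<^sup>L lborel K = (w - w * ln w) / n \<and>
      (\<integral>t. norm (K t) \<partial>lborel) \<le> (w + norm (w * ln w)) / n"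
  proof (cases "w = 0")
    case True
    then have "K = (\<lambda>t. 0)" by (auto simp: K_def indicator_def fun_eq_iff)
    with True show ?thesis by simp
  next
    case False
    with assms have w: "w > 0" by simp
    define a where "a = w powr (- 1 / n)"
    have a: "a > 0" using w by (simp add: a_def)
    have an: "1 / a ^ n = w"
      using w assms by (simp add: a_def powr_minus inverse_eq_divide power_divide powr_power)
    have lna: "ln a = - ln w / n" using w by (simp add: a_def ln_powr)
    have iff: "1 / t ^ n \<le> w \<longleftrightarrow> a \<le> t" if "t > 0" for t
    proof -
      have "1 / t ^ n \<le> w \<longleftrightarrow> a ^ n \<le> t ^ n"
        unfolding an[symmetric] using that a by (simp add: field_simps)
      also have "\<dots> \<longleftrightarrow> a \<le> t" using that a assms by (simp add: power_mono_iff)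
      finally show ?thesis .
    qed
    let ?K1 = "\<lambda>t. indicator {a..} t / t ^ (n + 1)"
    let ?J = "\<lambda>t. indicator {min a 1..max a 1} t / t :: real"
    let ?s = "if a \<le> 1 then - w else w"
    have K1: "has_bochner_integral lborel ?K1 (w / n)"
      using has_bochner_integral_inverse_power_tail[OF a \<open>n > 0\<close>]
      unfolding an[symmetric] by (simp only: divide_divide_eq_left mult.commute)
    have "ln (max a 1) - ln (min a 1) = \<bar>ln a\<bar>"
      using a by (cases "a \<le> 1") (auto simp: max_def min_def)
    also have "\<bar>ln a\<bar> = \<bar>ln w\<bar> / n" by (simp add: lna)
    finally have J: "has_bochner_integral lborel ?J (\<bar>ln w\<bar> / n)"
      using has_bochner_integral_inverse_Icc[of "min a 1" "max a 1"] a by simp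
    have "?s * \<bar>ln a\<bar> = w * ln a"
      using a ln_le_zero_iff[OF a] ln_ge_zero[of a] by (cases "a \<le> 1") auto
    then have "?s * (\<bar>ln w\<bar> / n) = w * ln a"
      by (simp only: \<open>\<bar>ln a\<bar> = \<bar>ln w\<bar> / n\<close>)
    then have total: "w / n + ?s * (\<bar>ln w\<bar> / n) = (w - w * ln w) / n"
      by (simp add: lna diff_divide_distrib)
    have sum: "has_bochner_integral lborel (\<lambda>t. ?K1 t + ?s * ?J t) ((w - w * ln w) / n)"
      unfolding total[symmetric]
      by (intro has_bochner_integral_add K1 has_bochner_integral_mult_right J)
    have sum': "has_bochner_integral lborel (\<lambda>t. ?K1 t + w * ?J t) (w / n + w * (\<bar>ln w\<bar> / n))"
      by (intro has_bochner_integral_add K1 has_bochner_integral_mult_right J)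
    \<comment> \<open>Up to the points a and 1, the truncation level w = 1/t^n being reached at t = a.\<close>
    have K_eq: "K t = ?K1 t + ?s * ?J t" if "t \<noteq> a" "t \<noteq> 1" for t
    proof (cases "t > 0")
      case True
      then show ?thesis using iff[OF True] that
        by (cases "a \<le> t"; cases "a \<le> 1")
           (auto simp: K_def indicator_def min_def max_def field_simps)
    qed (use a in \<open>auto simp: K_def indicator_def min_def\<close>)
    have K_AE: "AE t in lborel. K t = ?K1 t + ?s * ?J t"
      using AE_lborel_singleton[of a] AE_lborel_singleton[of "1::real"]
      by eventually_elim (rule K_eq)
    have [measurable]: "K \<in> borel_measurable borel"
      unfolding K_def by measurable
    have K: "has_bochner_integral lborel K ((w - w * ln w) / n)"
      using sum by (rule has_bochner_integral_cong_AE[THEN iffD1, rotated -1])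
        (use K_AE in \<open>auto elim!: eventually_mono\<close>)
    have "(\<integral>t. norm (K t) \<partial>lborel) \<le> (\<integral>t. ?K1 t + w * ?J t \<partial>lborel)"
    proof (rule integral_mono_AE)
      show "AE t in lborel. norm (K t) \<le> ?K1 t + w * ?J t"
        using K_AE
      proof eventually_elim
        case (elim t)
        have nonneg: "?K1 t \<ge> 0" "?J t \<ge> 0" using a by (auto simp: indicator_def)
        have "norm (?s * ?J t) = w * ?J t" "norm (?K1 t) = ?K1 t"
          unfolding real_norm_def abs_mult abs_of_nonneg[OF nonneg(1)] abs_of_nonneg[OF nonneg(2)]
          using w by auto
        then show ?case
          using norm_triangle_ineq[of "?K1 t" "?s * ?J t"] unfolding elim by linarith
      qed
    qed (use K sum' in \<open>auto simp: has_bochner_integral_iff\<close>)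
    also have "\<dots> = (w + norm (w * ln w)) / n"
      using sum' w by (simp add: has_bochner_integral_iff abs_mult add_divide_distrib)
    finally show ?thesis using K by (simp add: has_bochner_integral_iff)
  qed
  then show "integrable lborel K" "integral\<^sup>L lborel K = (w - w * ln w) / n"
    "(\<integral>t. norm (K t) \<partial>lborel) \<le> (w + norm (w * ln w)) / n" by simp_all
qed

section \<open>The representation for Borel data\<close>

text \<open>Here \<open>g y\<close> stands for \<open>f (x - y)\<close> and \<open>c\<close> for \<open>h 0\<close>; the latter is separate because a Borel
  representative of \<open>h\<close> may change the value at 0.\<close>

locale rough_kernel =
  fixes \<Omega> :: "'a::euclidean_space \<Rightarrow> complex" and h :: "real \<Rightarrow> complex" and c :: complex
    and g :: "'a \<Rightarrow> complex" and L R :: real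
  assumes \<Omega>_measurable [measurable]: "\<Omega> \<in> borel_measurable borel"
    and \<Omega>_integrable: "integrable sphere_measure \<Omega>"
    and \<Omega>_mean: "(\<integral>\<theta>. \<Omega> \<theta> \<partial>sphere_measure) = 0"
    and \<Omega>_log: "integrable sphere_measure (\<lambda>\<theta>. norm (\<Omega> \<theta>) * ln (norm (\<Omega> \<theta>)))"
    and h_measurable [measurable]: "h \<in> borel_measurable borel"
    and h_integrable: "\<And>r. integrable lborel (\<lambda>s. indicator {0<..r} s * norm (h s))"
    and h_Dini: "integrable lborel (\<lambda>s. indicator {0<..1} s * (norm (h s - c) / s))"
    and g_measurable [measurable]: "g \<in> borel_measurable borel"
    and g_Lipschitz: "norm (g y - g 0) \<le> L * norm y"
    and L_nonneg: "0 \<le> L"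
    and g_support: "R < norm y \<Longrightarrow> g y = 0"
    and R_ge_1: "1 \<le> R"
begin

text \<open>The radial function of the star-shaped set: the distance to its boundary in direction
  \<open>\<theta>\<close>.\<close>

definition \<omega> :: "'a \<Rightarrow> real" where "\<omega> \<theta> = norm (\<Omega> \<theta>) powr (1 / DIM('a))"

definition G :: "'a \<Rightarrow> complex" where
  "G y = h (norm y) * g y - c * g 0 * indicator {..1} (norm y)"

text \<open>\<open>\<Omega>\<close> is evaluated at \<open>sgn y\<close> because here it is a Borel
  function meaningful on the sphere only, with no homogeneity assumed.\<close>

definition K :: "'a \<Rightarrow> complex" where
  "K y = \<Omega> (sgn y) / of_real (norm y ^ DIM('a))"

lemma \<omega>_measurable [measurable]: "\<omega> \<in> borel_measurable borel"
  unfolding \<omega>_def by measurable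

lemma G_measurable [measurable]: "G \<in> borel_measurable borel"
  unfolding G_def by measurable

lemma K_measurable [measurable]: "K \<in> borel_measurable borel"
  unfolding K_def by measurable

lemma \<omega>_power: "\<omega> \<theta> ^ DIM('a) = norm (\<Omega> \<theta>)"
  by (cases "\<Omega> \<theta> = 0") (simp_all add: \<omega>_def powr_power)

section \<open>Absolute integrability of the regularised kernel, and the principal value\<close>

text \<open>In the unit ball \<open>h g - c g(0) = h (g - g(0)) + (h - c) g(0)\<close>, and the
  Lipschitz bound supplies the factor \<open>norm y\<close>. Beyond it
  \<open>1 \<le> norm y\<close>, so the Lipschitz bound yields
  \<open>norm (g y) \<le> (L + norm (g 0)) * norm y\<close> as well.\<close>

lemma norm_G_le:
  assumes "y \<noteq> 0"
  shows "norm (G y) \<le> (L + norm (g 0)) * (indicator {0<..R} (norm y) * norm y * norm (h (norm y)))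
    + norm (g 0) * (indicator {0<..1} (norm y) * norm (h (norm y) - c))"
proof (cases "norm y \<le> 1")
  case True
  have "G y = h (norm y) * (g y - g 0) + (h (norm y) - c) * g 0"
    using True by (simp add: G_def algebra_simps)
  also have "norm \<dots> \<le> norm (h (norm y)) * (L * norm y) + norm (h (norm y) - c) * norm (g 0)"
    using g_Lipschitz[of y]
    by (intro order.trans[OF norm_triangle_ineq] add_mono) (auto simp: norm_mult intro!: mult_left_mono)
  also have "\<dots> \<le> (L + norm (g 0)) * (norm y * norm (h (norm y))) + norm (g 0) * norm (h (norm y) - c)"
    by (simp add: algebra_simps)
  finally show ?thesis using True assms R_ge_1 by simp
next
  case False
  then have 1: "1 \<le> norm y" by simp
  show ?thesis
  proof (cases "norm y \<le> R")
    case True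
    have "norm (g y) \<le> norm (g 0) + L * norm y"
      using g_Lipschitz[of y] norm_triangle_ineq[of "g 0" "g y - g 0"] by simp
    also have "\<dots> \<le> norm (g 0) * norm y + L * norm y"
      using mult_left_mono[OF 1, of "norm (g 0)"] by simp
    finally have "norm (g y) \<le> (L + norm (g 0)) * norm y" by (simp add: algebra_simps)
    from mult_left_mono[OF this, of "norm (h (norm y))"]
    show ?thesis using True False assms by (simp add: G_def norm_mult mult_ac)
  next
    case False
    with g_support[of y] \<open>\<not> norm y \<le> 1\<close> show ?thesis by (simp add: G_def)
  qed
qed

text \<open>The polar weight \<open>r^(n-1)\<close> against \<open>r^-n\<close> leaves
  \<open>1/r\<close>. It cancels the factor \<open>r\<close> in \<open>\<phi>1\<close>, leaving the
  locally integrable |h|, and turns \<open>\<phi>2\<close> into the Dini integrand.\<close>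

lemma integrable_K_G: "integrable lborel (\<lambda>y. K y * G y)"
proof -
  define \<phi>1 where "\<phi>1 s = indicator {0<..R} s * s * norm (h s) / s ^ DIM('a)" for s
  define \<phi>2 where "\<phi>2 s = indicator {0<..1} s * norm (h s - c) / s ^ DIM('a)" for s
  have [measurable]: "\<phi>1 \<in> borel_measurable borel" "\<phi>2 \<in> borel_measurable borel"
    unfolding \<phi>1_def \<phi>2_def by measurable
  have pow: "s ^ (DIM('a) - Suc 0) * x / s ^ DIM('a) = x / s" if "s > 0" for s x :: real
    using that by (simp add: power_diff field_simps)
  have "(\<lambda>s. (indicator {0<..} s * s ^ (DIM('a) - 1)) *\<^sub>R \<phi>1 s) = (\<lambda>s. indicator {0<..R} s * norm (h s))"
    by (auto simp: \<phi>1_def indicator_def pow fun_eq_iff)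
  then have 1: "integrable (radial_measure DIM('a)) \<phi>1"
    using h_integrable[of R] by (subst integrable_radial_measure_iff) simp_all
  have "(\<lambda>s. (indicator {0<..} s * s ^ (DIM('a) - 1)) *\<^sub>R \<phi>2 s) = (\<lambda>s. indicator {0<..1} s * (norm (h s - c) / s))"
    by (auto simp: \<phi>2_def indicator_def pow fun_eq_iff)
  then have 2: "integrable (radial_measure DIM('a)) \<phi>2"
    using h_Dini by (subst integrable_radial_measure_iff) simp_all
  let ?\<phi> = "\<lambda>s. complex_of_real ((L + norm (g 0)) * \<phi>1 s + norm (g 0) * \<phi>2 s)"
  have "integrable (radial_measure DIM('a)) ?\<phi>"
    using 1 2 by (intro integrable_of_real Bochner_Integration.integrable_add integrable_mult_right)
  from integrable_polar_product[OF \<Omega>_integrable this]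
  show ?thesis
  proof (rule Bochner_Integration.integrable_bound)
    show "AE y in lborel. norm (K y * G y) \<le> norm (\<Omega> (sgn y) * ?\<phi> (norm y))"
      using AE_lborel_singleton[of "0::'a"]
    proof eventually_elim
      case (elim y)
      let ?d = "norm y ^ DIM('a)"
      have "norm (G y) / ?d \<le> (L + norm (g 0)) * \<phi>1 (norm y) + norm (g 0) * \<phi>2 (norm y)"
        using divide_right_mono[OF norm_G_le[OF elim], of ?d]
        by (simp add: \<phi>1_def \<phi>2_def add_divide_distrib)
      also have "\<dots> \<le> norm (?\<phi> (norm y))" by (simp only: norm_of_real abs_ge_self)
      finally have "norm (\<Omega> (sgn y)) * (norm (G y) / ?d) \<le> norm (\<Omega> (sgn y)) * norm (?\<phi> (norm y))"
        by (rule mult_left_mono) simp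
      then show ?case by (simp only: K_def norm_mult norm_divide norm_of_real norm_power) simp
    qed
  qed measurable
qed

lemma
  assumes "\<epsilon> > 0"
  shows integrable_K_annulus: "integrable lborel (\<lambda>y. K y * indicator {\<epsilon><..1} (norm y))"
    and integral_K_annulus: "(\<integral>y. K y * indicator {\<epsilon><..1} (norm y) \<partial>lborel) = 0"
proof -
  define \<phi> :: "real \<Rightarrow> complex" where "\<phi> s = indicator {\<epsilon><..1} s / of_real (s ^ DIM('a))" for s
  have [measurable]: "\<phi> \<in> borel_measurable borel"
    unfolding \<phi>_def by measurable
  have "integrable lborel (\<lambda>s. (indicator {0<..} s * s ^ (DIM('a) - 1)) *\<^sub>R \<phi> s)"
  proof (rule Bochner_Integration.integrable_bound)
    \<comment> \<open>On the annulus the remaining weight \<open>1/s\<close> is below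
      \<open>1/\<epsilon>\<close>; for \<open>\<epsilon> \<ge> 1\<close> the annulus is
      empty.\<close>
    show "integrable lborel (\<lambda>s. indicator {\<epsilon>..1} s / \<epsilon>)"
      by (intro integrable_divide integrable_real_indicator) (auto simp: emeasure_lborel_Icc_eq)
    show "AE s in lborel. norm ((indicator {0<..} s * s ^ (DIM('a) - 1)) *\<^sub>R \<phi> s)
        \<le> norm (indicator {\<epsilon>..1} s / \<epsilon>)"
      using assms
      by (auto simp: \<phi>_def indicator_def norm_divide norm_power power_diff field_simps)
  qed measurable
  then have \<phi>: "integrable (radial_measure DIM('a)) \<phi>"
    by (subst integrable_radial_measure_iff) simp_all
  have eq: "K y * indicator {\<epsilon><..1} (norm y) = \<Omega> (sgn y) * \<phi> (norm y)" for y
    by (simp add: K_def \<phi>_def)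
  show "integrable lborel (\<lambda>y. K y * indicator {\<epsilon><..1} (norm y))"
    unfolding eq using integrable_polar_product[OF \<Omega>_integrable \<phi>] by simp
  show "(\<integral>y. K y * indicator {\<epsilon><..1} (norm y) \<partial>lborel) = 0"
    unfolding eq using integral_polar_product[OF \<Omega>_integrable \<phi>] \<Omega>_mean by simp
qed

text \<open>Outside the ball of radius \<open>\<epsilon>\<close> the two integrands differ by a
  constant times \<open>K\<close> on the annulus from \<open>\<epsilon>\<close> to 1, whose integral
  vanishes by the mean value property.\<close>

lemma
  assumes "\<epsilon> > 0"
  shows integrable_truncated: "integrable lborel (\<lambda>y. indicator {\<epsilon><..} (norm y) *\<^sub>R (K y * h (norm y) * g y))"
    and integral_truncated: "(\<integral>y. indicator {\<epsilon><..} (norm y) *\<^sub>R (K y * h (norm y) * g y) \<partial>lborel) =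
      (\<integral>y. indicator {\<epsilon><..} (norm y) *\<^sub>R (K y * G y) \<partial>lborel)"
proof -
  have eq: "indicator {\<epsilon><..} (norm y) *\<^sub>R (K y * h (norm y) * g y) =
      indicator {\<epsilon><..} (norm y) *\<^sub>R (K y * G y) + c * g 0 * (K y * indicator {\<epsilon><..1} (norm y))" for y
    by (auto simp: G_def indicator_def algebra_simps)
  have 1: "integrable lborel (\<lambda>y. indicator {\<epsilon><..} (norm y) *\<^sub>R (K y * G y))"
    by (rule Bochner_Integration.integrable_bound[OF integrable_K_G]) (auto simp: indicator_def)
  have 2: "integrable lborel (\<lambda>y. c * g 0 * (K y * indicator {\<epsilon><..1} (norm y)))"
    using integrable_K_annulus[OF assms] by (rule integrable_mult_right)
  show "integrable lborel (\<lambda>y. indicator {\<epsilon><..} (norm y) *\<^sub>R (K y * h (norm y) * g y))"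
    unfolding eq using 1 2 by (rule Bochner_Integration.integrable_add)
  show "(\<integral>y. indicator {\<epsilon><..} (norm y) *\<^sub>R (K y * h (norm y) * g y) \<partial>lborel) =
      (\<integral>y. indicator {\<epsilon><..} (norm y) *\<^sub>R (K y * G y) \<partial>lborel)"
    unfolding eq Bochner_Integration.integral_add[OF 1 2]
    using integral_K_annulus[OF assms] by simp
qed

lemma tendsto_truncated:
  "((\<lambda>\<epsilon>. \<integral>y. indicator {\<epsilon><..} (norm y) *\<^sub>R (K y * h (norm y) * g y) \<partial>lborel)
     \<longlongrightarrow> (\<integral>y. K y * G y \<partial>lborel)) (at_right 0)"
proof -
  \<comment> \<open>The substitution \<open>\<epsilon> = 1/t\<close> brings the limit into the form
    of dominated convergence at infinity, with majorant the norm of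
    \<open>K y * G y\<close>.\<close>
  have "((\<lambda>t. \<integral>y. indicator {inverse t<..} (norm y) *\<^sub>R (K y * G y) \<partial>lborel)
      \<longlongrightarrow> (\<integral>y. K y * G y \<partial>lborel)) at_top"
  proof (rule integral_dominated_convergence_at_top)
    show "integrable lborel (\<lambda>y. norm (K y * G y))" using integrable_K_G by simp
    show "AE y in lborel. ((\<lambda>t. indicator {inverse t<..} (norm y) *\<^sub>R (K y * G y)) \<longlongrightarrow> K y * G y) at_top"
      using AE_lborel_singleton[of "0::'a"]
    proof eventually_elim
      case (elim y)
      have "eventually (\<lambda>t. inverse t < norm y) at_top"
        using elim by (intro order_tendstoD(2)[OF tendsto_inverse_0_at_top] filterlim_ident) auto
      then have "eventually (\<lambda>t. indicator {inverse t<..} (norm y) *\<^sub>R (K y * G y) = K y * G y) at_top"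
        by eventually_elim simp
      then show ?case by (rule tendsto_eventually)
    qed
  qed (auto simp: indicator_def)
  then have "((\<lambda>\<epsilon>. \<integral>y. indicator {\<epsilon><..} (norm y) *\<^sub>R (K y * G y) \<partial>lborel)
      \<longlongrightarrow> (\<integral>y. K y * G y \<partial>lborel)) (at_right 0)"
    by (simp add: filterlim_at_right_to_top)
  then show ?thesis
    by (rule filterlim_cong[THEN iffD1, rotated -1])
       (auto simp: eventually_at_right_field integral_truncated intro!: exI[of _ 1])
qed

section \<open>Integrability and evaluation of averages over dilated star sets\<close>

lemma \<omega>_nonneg: "0 \<le> \<omega> \<theta>"
  by (simp add: \<omega>_def)

lemma integrable_h_norm:
  "integrable lborel (\<lambda>y::'a. indicator {0<..R} (norm y) * norm (h (norm y)))"
proof -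
  interpret S: finite_measure "sphere_measure :: 'a measure" by (rule finite_measure_sphere_measure)
  let ?\<phi> = "\<lambda>s. complex_of_real (indicator {0<..R} s * norm (h s))"
  have "integrable (radial_measure DIM('a)) ?\<phi>"
  proof (subst integrable_radial_measure_iff)
    show "integrable lborel (\<lambda>s. (indicator {0<..} s * s ^ (DIM('a) - 1)) *\<^sub>R ?\<phi> s)"
    proof (rule Bochner_Integration.integrable_bound)
      \<comment> \<open>On the ball of radius \<open>R\<close> the polar weight is at most
        \<open>R^(n-1)\<close>.\<close>
      show "integrable lborel (\<lambda>s. R ^ (DIM('a) - 1) * (indicator {0<..R} s * norm (h s)))"
        using h_integrable[of R] by (rule integrable_mult_right)
      show "AE s in lborel. norm ((indicator {0<..} s * s ^ (DIM('a) - 1)) *\<^sub>R ?\<phi> s)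
          \<le> norm (R ^ (DIM('a) - 1) * (indicator {0<..R} s * norm (h s)))"
        using R_ge_1 by (auto simp: indicator_def abs_mult intro!: mult_right_mono power_mono)
    qed measurable
  qed measurable
  from integrable_polar_product[OF _ this, of "\<lambda>_. 1"]
  have "integrable lborel (\<lambda>y::'a. ?\<phi> (norm y))" by simp
  from integrable_Re[OF this] show ?thesis by simp
qed

text \<open>The star set may be unbounded, since \<open>\<Omega>\<close> may be; integrability comes
  from the support of \<open>g\<close> in the ball of radius \<open>R\<close>, where
  \<open>g\<close> is bounded by \<open>norm (g 0) + L * R\<close>.\<close>

lemma integrable_average:
  "integrable lborel (\<lambda>y. indicator {..t * \<omega> (sgn y)} (norm y) *\<^sub>R (h (norm y) * g y * sgn (\<Omega> (sgn y))))"
proof (rule Bochner_Integration.integrable_bound)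
  let ?M = "norm (g 0) + L * R"
  show "integrable lborel (\<lambda>y::'a. ?M * (indicator {0<..R} (norm y) * norm (h (norm y))))"
    using integrable_h_norm by (rule integrable_mult_right)
  show "AE y in lborel. norm (indicator {..t * \<omega> (sgn y)} (norm y) *\<^sub>R (h (norm y) * g y * sgn (\<Omega> (sgn y))))
      \<le> norm (?M * (indicator {0<..R} (norm y) * norm (h (norm y))))"
    using AE_lborel_singleton[of "0::'a"]
  proof eventually_elim
    case (elim y)
    show ?case
    proof (cases "norm y \<le> R")
      case True
      have "norm (g y) \<le> norm (g 0) + L * norm y"
        using g_Lipschitz[of y] norm_triangle_ineq[of "g 0" "g y - g 0"] by simp
      also have "\<dots> \<le> ?M" using True L_nonneg by (simp add: mult_left_mono)
      finally have "norm (g y) * norm (h (norm y)) \<le> ?M * norm (h (norm y))"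
        by (intro mult_right_mono) auto
      moreover have "norm (indicator {..t * \<omega> (sgn y)} (norm y) *\<^sub>R (h (norm y) * g y * sgn (\<Omega> (sgn y))))
          \<le> norm (g y) * norm (h (norm y))"
        by (auto simp: indicator_def norm_mult norm_sgn)
      ultimately show ?thesis using True elim L_nonneg R_ge_1 by (simp add: abs_mult)
    qed (use g_support[of y] in simp)
  qed
  show "(\<lambda>y. indicator {..t * \<omega> (sgn y)} (norm y) *\<^sub>R (h (norm y) * g y * sgn (\<Omega> (sgn y)))) \<in> borel_measurable lborel"
    unfolding indicator_def atMost_iff by measurable
qed

lemma integrable_unit_average:
  "integrable lborel (\<lambda>y::'a. indicator {..t * \<omega> (sgn y)} (norm y) *\<^sub>R (indicator {..1} (norm y) * sgn (\<Omega> (sgn y))))"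
proof (rule Bochner_Integration.integrable_bound)
  show "integrable lborel (indicator (cball (0::'a) 1) :: 'a \<Rightarrow> real)"
    by (rule integrable_real_indicator) (use emeasure_bounded_finite[OF bounded_cball, of "0::'a" 1] in auto)
  show "(\<lambda>y. indicator {..t * \<omega> (sgn y)} (norm y) *\<^sub>R (indicator {..1} (norm y) * sgn (\<Omega> (sgn y)))) \<in> borel_measurable lborel"
    unfolding indicator_def atMost_iff by measurable
qed (auto simp: indicator_def norm_sgn)

text \<open>In direction \<open>\<theta>\<close> the domain is a ray of length
  \<open>min 1 (t * \<omega> \<theta>)\<close>. Its radial mass is the n-th power of this length
  over n, and \<open>\<omega>^n\<close> is |\<Omega>|.\<close>

lemma integral_unit_average:
  assumes "t > 0"
  shows "(\<integral>y. indicator {..t * \<omega> (sgn y)} (norm y) *\<^sub>R (indicator {..1} (norm y) * sgn (\<Omega> (sgn y))) \<partial>lborel) =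
    (\<integral>\<theta>. (min 1 (t ^ DIM('a) * norm (\<Omega> \<theta>)) / DIM('a)) *\<^sub>R sgn (\<Omega> \<theta>) \<partial>sphere_measure)"
proof -
  \<comment> \<open>Requiring \<open>0 < r\<close> changes the integrand only at the origin and
    makes each ray a half-open interval.\<close>
  let ?F = "\<lambda>(\<theta>, r). (if 0 < r \<and> r \<le> min 1 (t * \<omega> \<theta>) then 1 else 0) *\<^sub>R sgn (\<Omega> \<theta>)"
  have F: "?F \<in> borel_measurable (borel \<Otimes>\<^sub>M borel)" by measurable
  have AE: "AE y in lborel. indicator {..t * \<omega> (sgn y)} (norm y) *\<^sub>R (indicator {..1} (norm y) * sgn (\<Omega> (sgn y))) = ?F (sgn y, norm y)"
    using AE_lborel_singleton[of "0::'a"] by eventually_elim auto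
  have F_int: "integrable lborel (\<lambda>y. ?F (sgn y, norm y))"
    by (rule Bochner_Integration.integrable_bound[OF integrable_unit_average[of t]])
       (use F AE in \<open>auto elim!: eventually_mono\<close>)
  have "(\<integral>y. indicator {..t * \<omega> (sgn y)} (norm y) *\<^sub>R (indicator {..1} (norm y) * sgn (\<Omega> (sgn y))) \<partial>lborel) =
      (\<integral>y. ?F (sgn y, norm y) \<partial>lborel)"
    by (rule integral_cong_AE) (use F AE integrable_unit_average[of t] in auto)
  also have "\<dots> = (\<integral>\<theta>. \<integral>r. ?F (\<theta>, r) \<partial>radial_measure DIM('a) \<partial>sphere_measure)"
    by (rule integral_polar[OF F F_int])
  also have "\<dots> = (\<integral>\<theta>. (min 1 (t ^ DIM('a) * norm (\<Omega> \<theta>)) / DIM('a)) *\<^sub>R sgn (\<Omega> \<theta>) \<partial>sphere_measure)"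
  proof (intro Bochner_Integration.integral_cong refl)
    fix \<theta>
    have "min 1 (t * \<omega> \<theta>) ^ DIM('a) = min 1 ((t * \<omega> \<theta>) ^ DIM('a))"
      using assms \<omega>_nonneg[of \<theta>] one_le_power[of "t * \<omega> \<theta>" "DIM('a)"] power_le_one[of "t * \<omega> \<theta>" "DIM('a)"]
      by (auto simp: min_def)
    then have pow: "min 1 (t * \<omega> \<theta>) ^ DIM('a) = min 1 (t ^ DIM('a) * norm (\<Omega> \<theta>))"
      by (simp add: power_mult_distrib \<omega>_power)
    have "(\<integral>r. ?F (\<theta>, r) \<partial>radial_measure DIM('a)) =
        (\<integral>r. indicator {0<..min 1 (t * \<omega> \<theta>)} r *\<^sub>R sgn (\<Omega> \<theta>) \<partial>radial_measure DIM('a))"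
      by (intro Bochner_Integration.integral_cong refl) (auto simp: indicator_def)
    also have "\<dots> = of_real (min 1 (t * \<omega> \<theta>) ^ DIM('a) / DIM('a)) * sgn (\<Omega> \<theta>)"
      using assms \<omega>_nonneg[of \<theta>] by (intro integral_radial_measure_Ioc) auto
    finally show "(\<integral>r. ?F (\<theta>, r) \<partial>radial_measure DIM('a)) =
        (min 1 (t ^ DIM('a) * norm (\<Omega> \<theta>)) / DIM('a)) *\<^sub>R sgn (\<Omega> \<theta>)"
      by (simp only: pow scaleR_conv_of_real)
  qed
  finally show ?thesis .
qed

section \<open>The regularised part by Fubini\<close>

text \<open>The weight \<open>t^-n\<close> of the average times the \<open>1/t\<close> of
  \<open>dt/t\<close>, on the pairs with \<open>y\<close> in the dilate by \<open>t\<close>: one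
  function of both variables, ready for Fubini.\<close>

definition D :: "real \<Rightarrow> 'a \<Rightarrow> real" where
  "D t y = (if 0 < t \<and> norm y \<le> t * \<omega> (sgn y) then 1 / t ^ (DIM('a) + 1) else 0)"

lemma D_measurable [measurable]: "(\<lambda>(y, t). D t y) \<in> borel_measurable (borel \<Otimes>\<^sub>M borel)"
  unfolding D_def by measurable

lemma D_nonneg: "0 \<le> D t y"
  by (simp add: D_def)

text \<open>A point \<open>y\<close> enters the dilates at
  \<open>t = norm y / \<omega> (sgn y)\<close>, so the integral is the power tail from there; its
  value turns \<open>\<omega>^n\<close> into |\<Omega>|.\<close>

lemma has_bochner_integral_D:
  assumes "y \<noteq> 0"
  shows "has_bochner_integral lborel (\<lambda>t. D t y) (norm (\<Omega> (sgn y)) / (DIM('a) * norm y ^ DIM('a)))"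
proof (cases "\<Omega> (sgn y) = 0")
  case True
  \<comment> \<open>Since \<open>0 powr p = 0\<close>, the radius \<open>\<omega>\<close> vanishes
    and no dilate reaches \<open>y \<noteq> 0\<close>.\<close>
  then have "(\<lambda>t. D t y) = (\<lambda>_. 0)" using assms by (auto simp: D_def \<omega>_def)
  with True show ?thesis by (simp add: has_bochner_integral_zero)
next
  case False
  then have \<omega>: "\<omega> (sgn y) > 0" by (simp add: \<omega>_def)
  let ?a = "norm y / \<omega> (sgn y)"
  have a: "?a > 0" using \<omega> assms by simp
  have "D t y = indicator {?a..} t / t ^ (DIM('a) + 1)" for t
  proof -
    have "norm y \<le> t * \<omega> (sgn y) \<longleftrightarrow> ?a \<le> t" using \<omega> by (simp add: field_simps)
    then show ?thesis using a by (auto simp: D_def indicator_def)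
  qed
  moreover have "1 / (DIM('a) * ?a ^ DIM('a)) = norm (\<Omega> (sgn y)) / (DIM('a) * norm y ^ DIM('a))"
    by (simp add: power_divide \<omega>_power)
  ultimately show ?thesis
    using has_bochner_integral_inverse_power_tail[OF a, of "DIM('a)"] by simp
qed

text \<open>The t-integral of \<open>D\<close> supplies |\<Omega>|/(n |y|^n), and \<open>sgn\<close>
  restores the phase, so the inner integral is \<open>K y * G y / n\<close>. With norms inside it is
  \<open>norm (K y * G y) / n\<close>, hence the integrability of \<open>K G\<close> is what permits
  the interchange.\<close>

lemma
  shows integrable_D_G: "integrable (lborel \<Otimes>\<^sub>M lborel) (\<lambda>(y, t). D t y *\<^sub>R (G y * sgn (\<Omega> (sgn y))))"
    and integral_D_G: "(\<integral>t. \<integral>y. D t y *\<^sub>R (G y * sgn (\<Omega> (sgn y))) \<partial>lborel \<partial>lborel) =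
      (\<integral>y. K y * G y \<partial>lborel) / of_nat DIM('a)"
proof -
  let ?f = "\<lambda>(y, t). D t y *\<^sub>R (G y * sgn (\<Omega> (sgn y)))"
  have norm_eq: "(\<integral>t. norm (?f (y, t)) \<partial>lborel) = norm (K y * G y) / DIM('a)" if "y \<noteq> 0" for y
  proof -
    have "(\<integral>t. norm (?f (y, t)) \<partial>lborel) = (\<integral>t. D t y * norm (G y * sgn (\<Omega> (sgn y))) \<partial>lborel)"
      by (simp add: D_nonneg)
    also have "\<dots> = norm (\<Omega> (sgn y)) / (DIM('a) * norm y ^ DIM('a)) * norm (G y * sgn (\<Omega> (sgn y)))"
      using has_bochner_integral_D[OF that] by (simp add: has_bochner_integral_iff)
    also have "\<dots> = norm (K y * G y) / DIM('a)"
      by (simp add: K_def norm_mult norm_divide norm_power norm_sgn)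
    finally show ?thesis .
  qed
  have int_eq: "(\<integral>t. ?f (y, t) \<partial>lborel) = K y * G y / of_nat DIM('a)" if "y \<noteq> 0" for y
  proof -
    have "(\<integral>t. ?f (y, t) \<partial>lborel) =
        (norm (\<Omega> (sgn y)) / (DIM('a) * norm y ^ DIM('a))) *\<^sub>R (G y * sgn (\<Omega> (sgn y)))"
      using has_bochner_integral_D[OF that] by (simp add: has_bochner_integral_iff)
    also have "\<dots> = K y * G y / of_nat DIM('a)"
      by (simp add: K_def scaleR_conv_of_real sgn_eq mult_ac)
    finally show ?thesis .
  qed
  show *: "integrable (lborel \<Otimes>\<^sub>M lborel) ?f"
  proof (rule lborel_pair.Fubini_integrable)
    show "integrable lborel (\<lambda>y. \<integral>t. norm (?f (y, t)) \<partial>lborel)"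
    proof (rule integrable_cong_AE_imp)
      show "integrable lborel (\<lambda>y. norm (K y * G y) / DIM('a))" using integrable_K_G by simp
      show "AE y in lborel. norm (K y * G y) / DIM('a) = (\<integral>t. norm (?f (y, t)) \<partial>lborel)"
        using AE_lborel_singleton[of "0::'a"] by eventually_elim (rule norm_eq[symmetric])
    qed measurable
    show "AE y in lborel. integrable lborel (\<lambda>t. ?f (y, t))"
      using AE_lborel_singleton[of "0::'a"]
      by eventually_elim (use has_bochner_integral_D in \<open>auto simp: has_bochner_integral_iff\<close>)
  qed measurable
  have "(\<integral>t. \<integral>y. D t y *\<^sub>R (G y * sgn (\<Omega> (sgn y))) \<partial>lborel \<partial>lborel) = (\<integral>y. \<integral>t. ?f (y, t) \<partial>lborel \<partial>lborel)"
    using lborel_pair.Fubini_integral[of "\<lambda>y t. D t y *\<^sub>R (G y * sgn (\<Omega> (sgn y)))"] * by simp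
  also have "\<dots> = (\<integral>y. K y * G y / of_nat DIM('a) \<partial>lborel)"
    by (intro integral_cong_AE)
       (use AE_lborel_singleton[of "0::'a"] in \<open>auto elim!: eventually_mono simp: int_eq[simplified]\<close>)
  finally show "(\<integral>t. \<integral>y. D t y *\<^sub>R (G y * sgn (\<Omega> (sgn y))) \<partial>lborel \<partial>lborel) =
      (\<integral>y. K y * G y \<partial>lborel) / of_nat DIM('a)" by simp
qed

text \<open>Subtracting \<open>w * indicator {..1} t\<close> does not change the integral over the sphere, since \<open>\<Omega>\<close> has mean
  value zero, but makes the kernel integrable near \<open>t = 0\<close>.\<close>

definition T :: "real \<Rightarrow> real \<Rightarrow> real" where
  "T t w = indicator {0<..} t * (min w (1 / t ^ DIM('a)) - w * indicator {..1} t) / t"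

lemma \<Omega>_log_complex: "integrable sphere_measure (\<lambda>\<theta>. \<Omega> \<theta> * of_real (ln (norm (\<Omega> \<theta>))))"
  by (rule Bochner_Integration.integrable_bound[OF \<Omega>_log]) (auto simp: norm_mult)

text \<open>The norm bound for the truncation kernel gives the majorant (|\<Omega>| + |\<Omega>
  log|\<Omega>||)/n on the sphere. In the value, the part \<Omega>/n integrates to 0 and only the
  logarithmic term survives.\<close>

lemma
  shows integrable_T: "integrable (sphere_measure \<Otimes>\<^sub>M lborel) (\<lambda>(\<theta>, t). T t (norm (\<Omega> \<theta>)) *\<^sub>R sgn (\<Omega> \<theta>))"
    and integral_T: "(\<integral>t. \<integral>\<theta>. T t (norm (\<Omega> \<theta>)) *\<^sub>R sgn (\<Omega> \<theta>) \<partial>sphere_measure \<partial>lborel) =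
      - (\<integral>\<theta>. \<Omega> \<theta> * of_real (ln (norm (\<Omega> \<theta>))) \<partial>sphere_measure) / of_nat DIM('a)"
proof -
  interpret pair_sigma_finite "sphere_measure :: 'a measure" "lborel :: real measure"
    by (rule pair_sigma_finite_sphere_lborel)
  let ?f = "\<lambda>(\<theta>, t). T t (norm (\<Omega> \<theta>)) *\<^sub>R sgn (\<Omega> \<theta>)"
  note T = integrable_truncation_kernel[where n="DIM('a)", folded T_def]
    integral_truncation_kernel[where n="DIM('a)", folded T_def]
    integral_norm_truncation_kernel[where n="DIM('a)", folded T_def]
  have [measurable]: "(\<lambda>(w, t). T t w) \<in> borel_measurable (borel \<Otimes>\<^sub>M borel)"
    unfolding T_def by measurable
  show *: "integrable (sphere_measure \<Otimes>\<^sub>M lborel) ?f"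
  proof (rule Fubini_integrable)
    show "integrable sphere_measure (\<lambda>\<theta>. \<integral>t. norm (?f (\<theta>, t)) \<partial>lborel)"
    proof (rule Bochner_Integration.integrable_bound)
      show "integrable sphere_measure (\<lambda>\<theta>. (norm (\<Omega> \<theta>) + norm (norm (\<Omega> \<theta>) * ln (norm (\<Omega> \<theta>)))) / DIM('a))"
        using \<Omega>_integrable \<Omega>_log by (intro integrable_divide Bochner_Integration.integrable_add integrable_norm)
      show "AE \<theta> in sphere_measure. norm (\<integral>t. norm (?f (\<theta>, t)) \<partial>lborel) \<le>
          norm ((norm (\<Omega> \<theta>) + norm (norm (\<Omega> \<theta>) * ln (norm (\<Omega> \<theta>)))) / DIM('a))"
      proof (rule AE_I2)
        fix \<theta> :: 'a
        have "norm (\<integral>t. norm (?f (\<theta>, t)) \<partial>lborel) = (\<integral>t. norm (?f (\<theta>, t)) \<partial>lborel)"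
          by simp
        also have "\<dots> \<le> (\<integral>t. norm (T t (norm (\<Omega> \<theta>))) \<partial>lborel)"
          using T(1)[of "norm (\<Omega> \<theta>)"]
          by (intro integral_mono integrable_norm) (auto simp: norm_sgn)
        also have "\<dots> \<le> (norm (\<Omega> \<theta>) + norm (norm (\<Omega> \<theta>) * ln (norm (\<Omega> \<theta>)))) / DIM('a)"
          using T(3)[of "norm (\<Omega> \<theta>)"] by simp
        also have "\<dots> \<le> norm \<dots>" by (simp only: real_norm_def abs_ge_self)
        finally show "norm (\<integral>t. norm (?f (\<theta>, t)) \<partial>lborel) \<le>
          norm ((norm (\<Omega> \<theta>) + norm (norm (\<Omega> \<theta>) * ln (norm (\<Omega> \<theta>)))) / DIM('a))" .
      qed
    qed measurable
    show "AE \<theta> in sphere_measure. integrable lborel (\<lambda>t. ?f (\<theta>, t))"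
      using T(1) by simp
  qed measurable
  have "(\<integral>t. \<integral>\<theta>. T t (norm (\<Omega> \<theta>)) *\<^sub>R sgn (\<Omega> \<theta>) \<partial>sphere_measure \<partial>lborel) =
      (\<integral>\<theta>. \<integral>t. T t (norm (\<Omega> \<theta>)) *\<^sub>R sgn (\<Omega> \<theta>) \<partial>lborel \<partial>sphere_measure)"
    using Fubini_integral[of "\<lambda>\<theta> t. T t (norm (\<Omega> \<theta>)) *\<^sub>R sgn (\<Omega> \<theta>)"] * by simp
  also have "\<dots> = (\<integral>\<theta>. \<Omega> \<theta> / of_nat DIM('a) - \<Omega> \<theta> * of_real (ln (norm (\<Omega> \<theta>))) / of_nat DIM('a) \<partial>sphere_measure)"
  proof (intro Bochner_Integration.integral_cong refl)
    fix \<theta> :: 'a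
    have "(\<integral>t. T t (norm (\<Omega> \<theta>)) *\<^sub>R sgn (\<Omega> \<theta>) \<partial>lborel) =
        ((norm (\<Omega> \<theta>) - norm (\<Omega> \<theta>) * ln (norm (\<Omega> \<theta>))) / DIM('a)) *\<^sub>R sgn (\<Omega> \<theta>)"
      using T(1,2)[of "norm (\<Omega> \<theta>)"] by simp
    also have "\<dots> = \<Omega> \<theta> / of_nat DIM('a) - \<Omega> \<theta> * of_real (ln (norm (\<Omega> \<theta>))) / of_nat DIM('a)"
      by (cases "\<Omega> \<theta> = 0") (simp_all add: scaleR_conv_of_real sgn_eq field_simps)
    finally show "(\<integral>t. T t (norm (\<Omega> \<theta>)) *\<^sub>R sgn (\<Omega> \<theta>) \<partial>lborel) =
      \<Omega> \<theta> / of_nat DIM('a) - \<Omega> \<theta> * of_real (ln (norm (\<Omega> \<theta>))) / of_nat DIM('a)" .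
  qed
  also have "\<dots> = - (\<integral>\<theta>. \<Omega> \<theta> * of_real (ln (norm (\<Omega> \<theta>))) \<partial>sphere_measure) / of_nat DIM('a)"
    using \<Omega>_integrable \<Omega>_log_complex \<Omega>_mean by (subst Bochner_Integration.integral_diff) auto
  finally show "(\<integral>t. \<integral>\<theta>. T t (norm (\<Omega> \<theta>)) *\<^sub>R sgn (\<Omega> \<theta>) \<partial>sphere_measure \<partial>lborel) =
      - (\<integral>\<theta>. \<Omega> \<theta> * of_real (ln (norm (\<Omega> \<theta>))) \<partial>sphere_measure) / of_nat DIM('a)" .
qed

section \<open>The representation formula for Borel data\<close>

definition average :: "real \<Rightarrow> complex" where
  "average t = 1 / of_real (t ^ DIM('a)) *
    (\<integral>y. indicator {..t * \<omega> (sgn y)} (norm y) *\<^sub>R (h (norm y) * g y * sgn (\<Omega> (sgn y))) \<partial>lborel)"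

text \<open>The term subtracted in \<open>T\<close> is a multiple of \<open>\<Omega>\<close>, so it
  disappears on integration over the sphere and what remains is the unit-ball average. The factor
  \<open>indicator {0<..} t\<close> allows the formula for all real \<open>t\<close>: for
  \<open>t \<le> 0\<close> both sides are 0.\<close>

lemma average_eq:
  "indicator {0<..} t *\<^sub>R (average t / of_real t) =
    (\<integral>y. D t y *\<^sub>R (G y * sgn (\<Omega> (sgn y))) \<partial>lborel) +
    c * g 0 / of_nat DIM('a) * (\<integral>\<theta>. T t (norm (\<Omega> \<theta>)) *\<^sub>R sgn (\<Omega> \<theta>) \<partial>sphere_measure)"
proof (cases "t > 0")
  case False
  then show ?thesis by (simp add: D_def T_def)
next
  case True
  let ?i = "\<lambda>y. indicator {..t * \<omega> (sgn y)} (norm y) :: real"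
  let ?u = "\<lambda>y. ?i y *\<^sub>R (indicator {..1} (norm y) * sgn (\<Omega> (sgn y)))"
  let ?m = "\<lambda>\<theta>. min 1 (t ^ DIM('a) * norm (\<Omega> \<theta>)) *\<^sub>R sgn (\<Omega> \<theta>)"
  interpret S: finite_measure "sphere_measure :: 'a measure" by (rule finite_measure_sphere_measure)
  have G_eq: "?i y *\<^sub>R (G y * sgn (\<Omega> (sgn y))) =
      ?i y *\<^sub>R (h (norm y) * g y * sgn (\<Omega> (sgn y))) - c * g 0 * ?u y" for y
    by (simp add: G_def algebra_simps scaleR_conv_of_real)
  have "(\<integral>y. ?i y *\<^sub>R (G y * sgn (\<Omega> (sgn y))) \<partial>lborel) =
      (\<integral>y. ?i y *\<^sub>R (h (norm y) * g y * sgn (\<Omega> (sgn y))) \<partial>lborel) - c * g 0 * (\<integral>y. ?u y \<partial>lborel)"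
    unfolding G_eq
    by (subst Bochner_Integration.integral_diff[OF integrable_average integrable_mult_right[OF integrable_unit_average]])
       (simp only: integral_mult_right_zero)
  then have avg: "average t = 1 / of_real (t ^ DIM('a)) *
      ((\<integral>y. ?i y *\<^sub>R (G y * sgn (\<Omega> (sgn y))) \<partial>lborel) + c * g 0 * (\<integral>y. ?u y \<partial>lborel))"
    by (simp add: average_def)
  have D_eq: "D t y *\<^sub>R z = (1 / t ^ (DIM('a) + 1)) *\<^sub>R (?i y *\<^sub>R z)" for y and z :: complex
    using True by (simp add: D_def)
  have m_int: "integrable sphere_measure ?m"
    by (rule S.integrable_const_bound[where B=1]) (use True in \<open>auto simp: norm_sgn min_def abs_mult\<close>)
  have u: "(\<integral>y. ?u y \<partial>lborel) = (\<integral>\<theta>. ?m \<theta> \<partial>sphere_measure) / of_nat DIM('a)"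
    using integral_unit_average[OF True] integral_scaleR_right[of sphere_measure "1 / DIM('a)" ?m]
    by (simp add: scaleR_conv_of_real)
  have T_eq: "T t (norm (\<Omega> \<theta>)) *\<^sub>R sgn (\<Omega> \<theta>) =
      (1 / t ^ (DIM('a) + 1)) *\<^sub>R ?m \<theta> - (indicator {..1} t / t) *\<^sub>R \<Omega> \<theta>" for \<theta>
  proof -
    have "min (norm (\<Omega> \<theta>)) (1 / t ^ DIM('a)) = min 1 (t ^ DIM('a) * norm (\<Omega> \<theta>)) / t ^ DIM('a)"
      using True by (auto simp: min_def field_simps)
    then have "T t (norm (\<Omega> \<theta>)) = 1 / t ^ (DIM('a) + 1) * min 1 (t ^ DIM('a) * norm (\<Omega> \<theta>)) - indicator {..1} t / t * norm (\<Omega> \<theta>)"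
      using True by (simp add: T_def diff_divide_distrib mult.commute)
    moreover have "norm (\<Omega> \<theta>) *\<^sub>R sgn (\<Omega> \<theta>) = \<Omega> \<theta>" by (cases "\<Omega> \<theta> = 0") (simp_all add: sgn_div_norm)
    ultimately show ?thesis by (metis scaleR_diff_left scaleR_scaleR)
  qed
  \<comment> \<open>The second term of \<open>T_eq\<close> drops out by
    \<open>\<Omega>_mean\<close>.\<close>
  have T_int: "(\<integral>\<theta>. T t (norm (\<Omega> \<theta>)) *\<^sub>R sgn (\<Omega> \<theta>) \<partial>sphere_measure) =
      (1 / t ^ (DIM('a) + 1)) *\<^sub>R (\<integral>\<theta>. ?m \<theta> \<partial>sphere_measure)"
    unfolding T_eq
    by (subst Bochner_Integration.integral_diff[OF integrable_scaleR_right integrable_scaleR_right])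
       (simp_all only: m_int \<Omega>_integrable \<Omega>_mean integral_scaleR_right scaleR_zero_right diff_zero HOL.simp_thms)
  \<comment> \<open>Pure algebra with the integrals replaced by variables: \<open>I\<close> is the
    integral with \<open>G\<close>, \<open>J\<close> the one over the sphere, \<open>z\<close>
    stands for \<open>c * g 0\<close>.\<close>
  have collect: "1 / of_real (t ^ DIM('a)) * (I + z * (J / of_nat DIM('a))) / of_real t =
      (1 / t ^ (DIM('a) + 1)) *\<^sub>R I + z / of_nat DIM('a) * ((1 / t ^ (DIM('a) + 1)) *\<^sub>R J)" for I J z :: complex
    using True by (simp add: scaleR_conv_of_real field_simps)
  have "indicator {0<..} t = (1 :: real)" using True by simp
  then show ?thesis
    unfolding D_eq T_int integral_scaleR_right avg u by (simp only: scaleR_one collect)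
qed

lemma
  shows integrable_average_div: "integrable lborel (\<lambda>t. indicator {0<..} t *\<^sub>R (average t / of_real t))"
    and integral_average_div: "of_nat DIM('a) * (\<integral>t. indicator {0<..} t *\<^sub>R (average t / of_real t) \<partial>lborel) =
      (\<integral>y. K y * G y \<partial>lborel) -
      c * g 0 / of_nat DIM('a) * (\<integral>\<theta>. \<Omega> \<theta> * of_real (ln (norm (\<Omega> \<theta>))) \<partial>sphere_measure)"
proof -
  interpret P: pair_sigma_finite "sphere_measure :: 'a measure" "lborel :: real measure"
    by (rule pair_sigma_finite_sphere_lborel)
  have 1: "integrable lborel (\<lambda>t. \<integral>y. D t y *\<^sub>R (G y * sgn (\<Omega> (sgn y))) \<partial>lborel)"
    using lborel_pair.integrable_snd[OF integrable_D_G] by simp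
  have 2: "integrable lborel (\<lambda>t. c * g 0 / of_nat DIM('a) *
      (\<integral>\<theta>. T t (norm (\<Omega> \<theta>)) *\<^sub>R sgn (\<Omega> \<theta>) \<partial>sphere_measure))"
    using P.integrable_snd[OF integrable_T] by (intro integrable_mult_right) simp
  show "integrable lborel (\<lambda>t. indicator {0<..} t *\<^sub>R (average t / of_real t))"
    unfolding average_eq using 1 2 by (rule Bochner_Integration.integrable_add)
  show "of_nat DIM('a) * (\<integral>t. indicator {0<..} t *\<^sub>R (average t / of_real t) \<partial>lborel) =
      (\<integral>y. K y * G y \<partial>lborel) -
      c * g 0 / of_nat DIM('a) * (\<integral>\<theta>. \<Omega> \<theta> * of_real (ln (norm (\<Omega> \<theta>))) \<partial>sphere_measure)"
    unfolding average_eq Bochner_Integration.integral_add[OF 1 2] integral_mult_right_zero integral_D_G integral_T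
    by (simp add: field_simps)
qed

end

section \<open>Borel representatives\<close>

lemma completion_ex_borel_measurable_complex:
  fixes f :: "'a \<Rightarrow> complex"
  assumes "f \<in> borel_measurable (completion M)"
  shows "\<exists>f'\<in>borel_measurable M. AE x in M. f x = f' x"
proof -
  have "(\<lambda>x. Re (f x)) \<in> borel_measurable (completion M)" "(\<lambda>x. Im (f x)) \<in> borel_measurable (completion M)"
    using assms by auto
  from this[THEN completion_ex_borel_measurable_real]
  obtain u v where [measurable]: "u \<in> borel_measurable M" "v \<in> borel_measurable M"
    and AE: "AE x in M. Re (f x) = u x" "AE x in M. Im (f x) = v x" by auto
  show ?thesis
  proof
    show "AE x in M. f x = Complex (u x) (v x)"
      using AE by eventually_elim (simp add: complex_eq_iff)
    have "(\<lambda>x. complex_of_real (u x) + \<i> * complex_of_real (v x)) \<in> borel_measurable M" by measurable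
    then show "(\<lambda>x. Complex (u x) (v x)) \<in> borel_measurable M" by (simp add: Complex_eq)
  qed
qed

text \<open>\<open>lebesgue\<close> is complete, so agreement almost everywhere with a Borel
  function already yields measurability. Every integral of the final statement is reduced to Borel
  data by this.\<close>

lemma
  fixes F F' :: "'a::euclidean_space \<Rightarrow> 'b::euclidean_space"
  assumes F': "F' \<in> borel_measurable borel" and AE: "AE x in lborel. F x = F' x"
  shows integrable_lebesgue_cong_borel: "integrable lebesgue F \<longleftrightarrow> integrable lborel F'"
    and integral_lebesgue_cong_borel: "integral\<^sup>L lebesgue F = integral\<^sup>L lborel F'"
proof -
  have F'_leb: "F' \<in> borel_measurable lebesgue"
    using measurable_completion[of F' lborel borel] F' by simp
  have AE': "AE x in lebesgue. F x = F' x" using AE by (rule AE_completion)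
  have F: "F \<in> borel_measurable lebesgue"
    by (rule borel_measurable_AE[OF F'_leb]) (use AE' in \<open>eventually_elim, simp\<close>)
  show "integrable lebesgue F \<longleftrightarrow> integrable lborel F'"
    using integrable_cong_AE[OF F F'_leb AE'] F' by (simp add: integrable_completion)
  show "integral\<^sup>L lebesgue F = integral\<^sup>L lborel F'"
    using integral_cong_AE[OF F F'_leb AE'] F' by (simp add: integral_completion)
qed

lemma lborel_distr_reflect: "distr lborel borel (\<lambda>y. x - y) = (lborel :: 'a::euclidean_space measure)"
  using lborel_affine[of "-1" x] by (simp add: density_1)

lemma AE_lborel_reflect:
  assumes "AE y::'a::euclidean_space in lborel. P y"
  shows "AE y in lborel. P (x - y)"
proof -
  obtain N where "{y \<in> space lborel. \<not> P y} \<subseteq> N" "emeasure lborel N = 0" "N \<in> sets lborel"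
    using AE_E[OF assms] by blast
  then have N: "{y. \<not> P y} \<subseteq> N" "emeasure lborel N = 0" and [measurable]: "N \<in> sets borel" by simp_all
  have "emeasure (distr lborel borel (\<lambda>y. x - y)) N = emeasure lborel {y. x - y \<in> N}"
    by (subst emeasure_distr) (auto intro!: arg_cong[where f="emeasure lborel"])
  with N have "emeasure lborel {y. x - y \<in> N} = 0" by (simp add: lborel_distr_reflect)
  with N(1) show ?thesis by (intro AE_I[where N="{y. x - y \<in> N}"]) auto
qed

section \<open>Transfer of the hypotheses on the sphere\<close>

lemma surface_measure_borel_representative:
  fixes \<Omega> :: "'a::euclidean_space \<Rightarrow> complex"
  assumes "\<Omega> \<in> borel_measurable surface_measure"
  obtains \<Omega>' where "\<Omega>' \<in> borel_measurable borel" "AE \<theta> in sphere_premeasure. \<Omega> \<theta> = \<Omega>' \<theta>"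
proof -
  obtain f where f: "f \<in> borel_measurable sphere_premeasure" "AE \<theta> in sphere_premeasure. \<Omega> \<theta> = f \<theta>"
    using completion_ex_borel_measurable_complex[OF assms[unfolded surface_measure_eq_completion]] by blast
  \<comment> \<open>Extension by 0 off the sphere gives a Borel function on the whole space.\<close>
  have "(\<lambda>\<theta>. indicator (sphere 0 1) \<theta> *\<^sub>R f \<theta>) \<in> borel_measurable borel"
  proof (rule borel_measurable_restrict_space_iff[THEN iffD1])
    show "f \<in> borel_measurable (restrict_space borel (sphere 0 1))"
      using f(1) measurable_cong_sets[OF sets_sphere_premeasure refl] by blast
  qed auto
  moreover have "AE \<theta> in sphere_premeasure. \<Omega> \<theta> = indicator (sphere 0 1) \<theta> *\<^sub>R f \<theta>"
    using f(2) AE_space by eventually_elim (simp add: space_sphere_premeasure)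
  ultimately show ?thesis by (rule that)
qed

text \<open>Stated for a composition with \<open>F\<close> so as to cover both the mean value
  (\<open>F\<close> the identity) and the logarithmic constant.\<close>

lemma integral_surface_measure:
  fixes F :: "complex \<Rightarrow> complex"
  assumes \<Omega>: "\<Omega> \<in> borel_measurable surface_measure"
    and \<Omega>': "\<Omega>' \<in> borel_measurable borel" "AE \<theta> in sphere_premeasure. \<Omega> \<theta> = \<Omega>' \<theta>"
    and F [measurable]: "F \<in> borel_measurable borel"
  shows "(\<integral>\<theta>. F (\<Omega> \<theta>) \<partial>surface_measure) = (\<integral>\<theta>. F (\<Omega>' \<theta>) \<partial>sphere_measure)"
proof -
  have meas: "(\<lambda>\<theta>. F (\<Omega>' \<theta>)) \<in> borel_measurable sphere_premeasure"
    using measurable_compose[OF measurable_ident_sphere_premeasure measurable_compose[OF \<Omega>'(1) F]] by simp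
  have "(\<integral>\<theta>. F (\<Omega> \<theta>) \<partial>surface_measure) = (\<integral>\<theta>. F (\<Omega>' \<theta>) \<partial>completion sphere_premeasure)"
    unfolding surface_measure_eq_completion
  proof (rule integral_cong_AE)
    show "(\<lambda>\<theta>. F (\<Omega> \<theta>)) \<in> borel_measurable (completion sphere_premeasure)"
      using measurable_compose[OF \<Omega> F] by (simp only: surface_measure_eq_completion)
    show "(\<lambda>\<theta>. F (\<Omega>' \<theta>)) \<in> borel_measurable (completion sphere_premeasure)"
      using meas by (rule measurable_completion)
    show "AE \<theta> in completion sphere_premeasure. F (\<Omega> \<theta>) = F (\<Omega>' \<theta>)"
      using AE_completion[OF \<Omega>'(2)] by eventually_elim simp
  qed
  also have "\<dots> = (\<integral>\<theta>. F (\<Omega>' \<theta>) \<partial>sphere_measure)"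
    unfolding sphere_measure_def integral_completion[OF meas]
    using \<Omega>'(1) by (subst integral_distr[OF measurable_ident_sphere_premeasure]) auto
  finally show ?thesis .
qed

lemma nn_integral_surface_measure:
  fixes F :: "complex \<Rightarrow> ennreal"
  assumes \<Omega>': "\<Omega>' \<in> borel_measurable borel" "AE \<theta> in sphere_premeasure. \<Omega> \<theta> = \<Omega>' \<theta>"
    and F [measurable]: "F \<in> borel_measurable borel"
  shows "(\<integral>\<^sup>+\<theta>. F (\<Omega> \<theta>) \<partial>surface_measure) = (\<integral>\<^sup>+\<theta>. F (\<Omega>' \<theta>) \<partial>sphere_measure)"
proof -
  have "(\<integral>\<^sup>+\<theta>. F (\<Omega> \<theta>) \<partial>surface_measure) = (\<integral>\<^sup>+\<theta>. F (\<Omega>' \<theta>) \<partial>sphere_premeasure)"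
    unfolding surface_measure_eq_completion nn_integral_completion
    by (rule nn_integral_cong_AE) (use \<Omega>'(2) in \<open>eventually_elim, simp\<close>)
  also have "\<dots> = (\<integral>\<^sup>+\<theta>. F (\<Omega>' \<theta>) \<partial>sphere_measure)"
    unfolding sphere_measure_def
    using \<Omega>'(1) by (subst nn_integral_distr[OF measurable_ident_sphere_premeasure]) auto
  finally show ?thesis .
qed

text \<open>Only \<open>0 < w < 1\<close> needs an argument: \<open>ln (1/w) \<le> 1/w - 1\<close>
  gives \<open>- w * ln w \<le> 1 - w\<close>. The additive 1 is affordable because the sphere has
  finite measure.\<close>

lemma abs_mult_ln_le:
  fixes w :: real
  assumes "w \<ge> 0"
  shows "\<bar>w * ln w\<bar> \<le> w * log_plus w + 1"
proof (cases "w = 0 \<or> 1 \<le> w")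
  case True
  then show ?thesis by (auto simp: log_plus_def abs_mult)
next
  case False
  with assms have w: "0 < w" "w < 1" by auto
  have "ln (1 / w) \<le> 1 / w - 1" using w by (intro ln_le_minus_one) auto
  then have "w * - ln w \<le> w * (1 / w - 1)" using w by (intro mult_left_mono) (auto simp: ln_div)
  also have "\<dots> \<le> 1" using w by (simp add: field_simps)
  finally show ?thesis using w by (simp add: log_plus_def abs_mult abs_of_neg max_def)
qed

lemma
  fixes \<Omega> :: "'a::euclidean_space \<Rightarrow> complex"
  assumes [measurable]: "\<Omega> \<in> borel_measurable borel"
    and fin: "(\<integral>\<^sup>+\<theta>. ennreal (norm (\<Omega> \<theta>) * (1 + log_plus (norm (\<Omega> \<theta>)))) \<partial>sphere_measure) < \<infinity>"
  shows L_log_L_integrable: "integrable sphere_measure \<Omega>"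
    and L_log_L_integrable_log: "integrable sphere_measure (\<lambda>\<theta>. norm (\<Omega> \<theta>) * ln (norm (\<Omega> \<theta>)))"
proof -
  interpret S: finite_measure "sphere_measure :: 'a measure" by (rule finite_measure_sphere_measure)
  have nonneg: "0 \<le> norm z * log_plus (norm z)" for z :: complex by (simp add: log_plus_def)
  have [measurable]: "log_plus \<in> borel_measurable borel" unfolding log_plus_def by measurable
  let ?b = "\<lambda>\<theta>. norm (\<Omega> \<theta>) * (1 + log_plus (norm (\<Omega> \<theta>)))"
  have b: "integrable sphere_measure ?b"
    using fin nonneg by (intro integrableI_nonneg) (auto simp: distrib_left)
  show "integrable sphere_measure \<Omega>"
    by (rule Bochner_Integration.integrable_bound[OF b])
       (use nonneg in \<open>auto simp: distrib_left\<close>)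
  show "integrable sphere_measure (\<lambda>\<theta>. norm (\<Omega> \<theta>) * ln (norm (\<Omega> \<theta>)))"
  proof (rule Bochner_Integration.integrable_bound)
    show "integrable sphere_measure (\<lambda>\<theta>. ?b \<theta> + 1)" using b by simp
    show "AE \<theta> in sphere_measure. norm (norm (\<Omega> \<theta>) * ln (norm (\<Omega> \<theta>))) \<le> norm (?b \<theta> + 1)"
    proof (rule AE_I2)
      fix \<theta>
      have "norm (norm (\<Omega> \<theta>) * ln (norm (\<Omega> \<theta>))) \<le> norm (\<Omega> \<theta>) * log_plus (norm (\<Omega> \<theta>)) + 1"
        using abs_mult_ln_le[of "norm (\<Omega> \<theta>)"] by simp
      also have "\<dots> \<le> norm (?b \<theta> + 1)"
        using nonneg[of "\<Omega> \<theta>"] by (simp add: distrib_left)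
      finally show "norm (norm (\<Omega> \<theta>) * ln (norm (\<Omega> \<theta>))) \<le> norm (?b \<theta> + 1)" .
    qed
  qed measurable
qed

section \<open>Consequences of the hypotheses on \<open>h\<close> and \<open>f\<close>\<close>

text \<open>The growth bound controls only intervals away from 0. The intervals from
  \<open>r/2^(k+1)\<close> to \<open>r/2^k\<close> cover the half-open interval up to
  \<open>r\<close>, and their bounds \<open>C * r / 2^(k+1)\<close> form a convergent geometric
  series.\<close>

lemma nn_integral_Ioc_of_dyadic_bound:
  fixes u :: "real \<Rightarrow> ennreal"
  assumes [measurable]: "u \<in> borel_measurable borel" and C: "C \<ge> 0"
    and bound: "\<And>R. R > 0 \<Longrightarrow> (\<integral>\<^sup>+s. u s * indicator {R..2 * R} s \<partial>lborel) \<le> ennreal (C * R)"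
  shows "(\<integral>\<^sup>+s. u s * indicator {0<..r} s \<partial>lborel) < \<infinity>"
proof (cases "r > 0")
  case False
  then have "{0<..r} = {}" by auto
  then show ?thesis by simp
next
  case True
  let ?R = "\<lambda>k. r * (1 / 2) ^ Suc k"
  have le: "u s * indicator {0<..r} s \<le> (\<Sum>k. u s * indicator {?R k..2 * ?R k} s)" for s
  proof (cases "s \<in> {0<..r}")
    case False
    then show ?thesis by simp
  next
    case s: True
    obtain m where "(1 / 2) ^ m < s / r"
      using real_arch_pow_inv[of "s / r" "1 / 2"] s True by auto
    then have ex: "r * (1 / 2) ^ m \<le> s" using True by (simp add: field_simps)
    \<comment> \<open>The first dyadic level not above \<open>s\<close>; then \<open>s\<close> lies
      in the interval with index \<open>k - 1\<close>, while \<open>k = 0\<close> forces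
      \<open>s = r\<close>, the right end of the interval with index 0.\<close>
    define k where "k = (LEAST m. r * (1 / 2) ^ m \<le> s)"
    have k: "r * (1 / 2) ^ k \<le> s" unfolding k_def using ex by (rule LeastI)
    have "\<exists>j. s \<in> {?R j..2 * ?R j}"
    proof (cases k)
      case 0
      with k s have "s = r" by simp
      then show ?thesis using True by (intro exI[of _ 0]) simp
    next
      case (Suc j)
      then have "\<not> r * (1 / 2) ^ j \<le> s" unfolding k_def by (intro not_less_Least) simp
      with k Suc show ?thesis by (intro exI[of _ j]) simp
    qed
    then obtain j where "s \<in> {?R j..2 * ?R j}" ..
    then have "u s * indicator {0<..r} s = (\<Sum>k\<in>{j}. u s * indicator {?R k..2 * ?R k} s)"
      using s by simp
    also have "\<dots> \<le> (\<Sum>k. u s * indicator {?R k..2 * ?R k} s)"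
      by (rule sum_le_suminf) auto
    finally show ?thesis .
  qed
  have "(\<integral>\<^sup>+s. u s * indicator {0<..r} s \<partial>lborel) \<le> (\<integral>\<^sup>+s. (\<Sum>k. u s * indicator {?R k..2 * ?R k} s) \<partial>lborel)"
    by (rule nn_integral_mono) (rule le)
  also have "\<dots> = (\<Sum>k. \<integral>\<^sup>+s. u s * indicator {?R k..2 * ?R k} s \<partial>lborel)"
    by (rule nn_integral_suminf) measurable
  also have "\<dots> \<le> (\<Sum>k. ennreal (C * ?R k))"
    using True by (intro suminf_le bound summableI) auto
  also have "\<dots> = ennreal (\<Sum>k. C * ?R k)"
    using True C
    by (intro suminf_ennreal2) (auto intro!: summable_mult summable_geometric)
  also have "\<dots> < \<infinity>" by simp
  finally show ?thesis .
qed

text \<open>On the ball of radius \<open>R\<close> about \<open>x\<close> the mean value inequality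
  applies with \<open>B\<close> bounding the derivative there. Outside, \<open>f (x - y) = 0\<close>
  and \<open>1 \<le> norm y\<close>, so the difference is at most
  \<open>norm (f x) * norm y\<close>. Hence \<open>L = B + norm (f x)\<close>.\<close>

lemma C1_compact_support_Lipschitz_at:
  fixes f :: "'a::euclidean_space \<Rightarrow> complex"
  assumes "f \<in> C1_compact_support"
  obtains L R where "0 \<le> L" "1 \<le> R" "\<And>y. norm (f (x - y) - f x) \<le> L * norm y"
    "\<And>y. R < norm y \<Longrightarrow> f (x - y) = 0"
proof -
  obtain f' :: "'a \<Rightarrow> 'a \<Rightarrow>\<^sub>L complex" where f': "\<And>z. (f has_derivative blinfun_apply (f' z)) (at z)"
    and cont: "continuous_on UNIV f'" and supp: "compact (closure {z. f z \<noteq> 0})"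
    using assms by (auto simp: C1_compact_support_def)
  have "bounded {z. f z \<noteq> 0}"
    using bounded_subset[OF compact_imp_bounded[OF supp] closure_subset] .
  then obtain b where b: "\<And>z. f z \<noteq> 0 \<Longrightarrow> dist x z \<le> b"
    by (auto simp: bounded_any_center[where a=x])
  define R where "R = max 1 b"
  have zero: "f (x - y) = 0" if "R < norm y" for y
    using b[of "x - y"] that by (auto simp: R_def dist_norm)
  have "compact (f' ` cball x R)"
    using continuous_on_subset[OF cont] by (intro compact_continuous_image) auto
  then obtain B where B: "\<And>z. z \<in> cball x R \<Longrightarrow> norm (f' z) \<le> B"
    using compact_imp_bounded[of "f' ` cball x R"] unfolding bounded_iff by blast
  have "0 \<le> R" by (simp add: R_def)
  have "0 \<le> B" using B[of x] norm_ge_zero[of "f' x"] \<open>0 \<le> R\<close> by (simp del: norm_ge_zero)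
  show thesis
  proof (rule that)
    show "0 \<le> B + norm (f x)" using \<open>0 \<le> B\<close> by simp
    show "1 \<le> R" by (simp add: R_def)
    show "f (x - y) = 0" if "R < norm y" for y using that by (rule zero)
    show "norm (f (x - y) - f x) \<le> (B + norm (f x)) * norm y" for y
    proof (cases "norm y \<le> R")
      case True
      have "norm (f (x - y) - f x) \<le> B * norm (x - y - x)"
      proof (rule differentiable_bound)
        show "(f has_derivative blinfun_apply (f' z)) (at z within cball x R)" for z
          using f' by (rule has_derivative_at_withinI)
        show "onorm (blinfun_apply (f' z)) \<le> B" if "z \<in> cball x R" for z
          using B[OF that] by (simp add: norm_blinfun.rep_eq)
      qed (use True \<open>0 \<le> R\<close> in \<open>auto simp: dist_norm\<close>)
      also have "\<dots> \<le> (B + norm (f x)) * norm y" by (simp add: distrib_right)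
      finally show ?thesis .
    next
      case False
      then have "1 \<le> norm y" by (simp add: R_def)
      from mult_left_mono[OF this, of "norm (f x)"] \<open>0 \<le> B\<close>
      have "norm (f x) \<le> (B + norm (f x)) * norm y" by (simp add: distrib_right add_increasing)
      then show ?thesis using zero[of y] False by simp
    qed
  qed
qed

lemma C1_compact_support_borel_measurable:
  assumes "f \<in> C1_compact_support"
  shows "f \<in> borel_measurable borel"
proof -
  have "continuous_on UNIV f"
    using assms by (auto simp: C1_compact_support_def intro: has_derivative_continuous_on has_derivative_at_withinI)
  then show ?thesis by (rule borel_measurable_continuous_onI)
qed

lemma class_H1_borel_representative:
  assumes "h \<in> class_H1"
  obtains h' where "h' \<in> borel_measurable borel" "AE r in lborel. 0 < r \<longrightarrow> h r = h' r"
    "\<And>r. integrable lborel (\<lambda>s. indicator {0<..r} s * norm (h' s))"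
proof -
  obtain C where h: "h \<in> borel_measurable (lebesgue_on {0<..})" and C: "C > 0"
    and bound: "\<And>R. R > 0 \<Longrightarrow> (\<integral>\<^sup>+r\<in>{R..2 * R}. ennreal (norm (h r)) \<partial>lebesgue) \<le> ennreal (C * R)"
    using assms unfolding class_H1_def by blast
  \<comment> \<open>Extended by 0 to the whole line, \<open>h\<close> is tied to its representative
    on positive radii only, which is where the dyadic bounds live.\<close>
  have "(\<lambda>r. indicator {0<..} r *\<^sub>R h r) \<in> borel_measurable lebesgue"
    using h by (subst (asm) borel_measurable_restrict_space_iff) auto
  from completion_ex_borel_measurable_complex[OF this]
  obtain h' where h': "h' \<in> borel_measurable lborel"
    and eq: "AE r in lborel. indicator {0<..} r *\<^sub>R h r = h' r" by blast
  from h' have [measurable]: "h' \<in> borel_measurable borel" by simp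
  have AE: "AE r in lborel. 0 < r \<longrightarrow> h r = h' r"
    using eq by eventually_elim auto
  have "integrable lborel (\<lambda>s. indicator {0<..r} s * norm (h' s))" for r
  proof (rule integrableI_nonneg)
    have "(\<integral>\<^sup>+s. ennreal (norm (h' s)) * indicator {R..2 * R} s \<partial>lborel) \<le> ennreal (C * R)" if "R > 0" for R
    proof -
      have "(\<integral>\<^sup>+s. ennreal (norm (h' s)) * indicator {R..2 * R} s \<partial>lborel) =
          (\<integral>\<^sup>+r\<in>{R..2 * R}. ennreal (norm (h r)) \<partial>lebesgue)"
        unfolding nn_integral_completion
        by (rule nn_integral_cong_AE) (use AE in \<open>eventually_elim, use that in \<open>auto simp: indicator_def\<close>\<close>)
      with bound[OF that] show ?thesis by simp
    qed
    then have "(\<integral>\<^sup>+s. ennreal (norm (h' s)) * indicator {0<..r} s \<partial>lborel) < \<infinity>"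
      using C by (intro nn_integral_Ioc_of_dyadic_bound[where C=C]) auto
    also have "(\<integral>\<^sup>+s. ennreal (norm (h' s)) * indicator {0<..r} s \<partial>lborel) =
        (\<integral>\<^sup>+s. ennreal (indicator {0<..r} s * norm (h' s)) \<partial>lborel)"
      by (intro nn_integral_cong) (auto simp: indicator_def)
    finally show "(\<integral>\<^sup>+s. ennreal (indicator {0<..r} s * norm (h' s)) \<partial>lborel) < \<infinity>" .
  qed auto
  with AE show thesis by (intro that[of h']) auto
qed

section \<open>The representation theorem\<close>

lemma homogeneous_degree_0_sgn:
  fixes y :: "'a::euclidean_space"
  assumes "homogeneous_degree_0 \<Omega>" "y \<noteq> 0"
  shows "\<Omega> (sgn y) = \<Omega> y"
  using assms unfolding homogeneous_degree_0_def sgn_div_norm by simp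

text \<open>Homogeneity gives \<open>\<Omega>\<close> the same value at \<open>y\<close> and
  \<open>y/t\<close>, so dilating the set just multiplies its radial function by
  \<open>t\<close>.\<close>

lemma mem_scaled_star_set_iff:
  fixes y :: "'a::euclidean_space"
  assumes "homogeneous_degree_0 \<Omega>" "y \<noteq> 0" "t > 0"
  shows "y \<in> (*\<^sub>R) t ` star_set \<Omega> \<longleftrightarrow> norm y \<le> t * norm (\<Omega> y) powr (1 / DIM('a))"
proof -
  have "y \<in> (*\<^sub>R) t ` star_set \<Omega> \<longleftrightarrow> inverse t *\<^sub>R y \<in> star_set \<Omega>"
    using assms by (auto simp: image_iff intro!: bexI[of _ "inverse t *\<^sub>R y"])
  also have "\<dots> \<longleftrightarrow> norm y \<le> t * norm (\<Omega> (inverse t *\<^sub>R y)) powr (1 / DIM('a))"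
    using assms by (simp add: star_set_def field_simps)
  also have "\<Omega> (inverse t *\<^sub>R y) = \<Omega> y"
    using assms unfolding homogeneous_degree_0_def by simp
  finally show ?thesis .
qed

text \<open>For fixed \<open>x\<close>, every integrand is matched almost everywhere with its
  counterpart in \<open>rough_kernel\<close>, taken for representatives \<open>W\<close> of
  \<open>\<Omega>\<close> and \<open>k\<close> of \<open>h\<close> and for the function
  \<open>f (x - y)\<close> of \<open>y\<close>.\<close>

lemma rough_singular_integral_eq:
  fixes \<Omega> :: "'a::euclidean_space \<Rightarrow> complex" and h :: "real \<Rightarrow> complex"
  assumes \<Omega>: "\<Omega> \<in> L_log_L_sphere"
    and hom: "homogeneous_degree_0 \<Omega>"
    and mean: "(\<integral>\<theta>. \<Omega> \<theta> \<partial>surface_measure) = 0"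
    and h: "h \<in> class_H1"
    and Dini: "(\<integral>\<^sup>+t\<in>{0<..1}. ennreal (norm (h t - h 0) / t) \<partial>lebesgue) < \<infinity>"
    and f: "f \<in> C1_compact_support"
  shows "\<forall>\<epsilon>>0. set_integrable lebesgue {y. norm (x - y) > \<epsilon>} (kernel_integrand \<Omega> h f x)" (is ?A)
    and "((\<lambda>\<epsilon>. truncated_op \<Omega> h \<epsilon> f x) \<longlongrightarrow> singular_op \<Omega> h f x) (at_right 0)" (is ?B)
    and "\<forall>t>0. set_integrable lebesgue ((*\<^sub>R) t ` star_set \<Omega>) (average_integrand \<Omega> h f x)" (is ?C)
    and "set_integrable lebesgue {0<..} (\<lambda>t. star_average \<Omega> h t f x / of_real t)" (is ?D)
    and "singular_op \<Omega> h f x =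
      of_nat DIM('a) * (LINT t:{0<..}|lebesgue. star_average \<Omega> h t f x / of_real t)
      + h 0 * log_constant \<Omega> * f x" (is ?E)
proof -
  have \<Omega>_meas: "\<Omega> \<in> borel_measurable surface_measure"
    and \<Omega>_fin: "(\<integral>\<^sup>+\<theta>. ennreal (norm (\<Omega> \<theta>) * (1 + log_plus (norm (\<Omega> \<theta>)))) \<partial>surface_measure) < \<infinity>"
    using \<Omega> unfolding L_log_L_sphere_def by auto
  obtain W where W [measurable]: "W \<in> borel_measurable borel"
    and W_eq: "AE \<theta> in sphere_premeasure. \<Omega> \<theta> = W \<theta>"
    using surface_measure_borel_representative[OF \<Omega>_meas] by blast
  obtain k where k [measurable]: "k \<in> borel_measurable borel" and k_eq: "AE r in lborel. 0 < r \<longrightarrow> h r = k r"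
    and k_int: "\<And>r. integrable lborel (\<lambda>s. indicator {0<..r} s * norm (k s))"
    using class_H1_borel_representative[OF h] by blast
  obtain L R where LR: "0 \<le> L" "1 \<le> R" "\<And>y. norm (f (x - y) - f x) \<le> L * norm y"
    "\<And>y. R < norm y \<Longrightarrow> f (x - y) = 0"
    using C1_compact_support_Lipschitz_at[OF f, of x] by blast
  have [measurable]: "f \<in> borel_measurable borel" by (rule C1_compact_support_borel_measurable[OF f])
  have [measurable]: "log_plus \<in> borel_measurable borel" unfolding log_plus_def by measurable
  have W_fin: "(\<integral>\<^sup>+\<theta>. ennreal (norm (W \<theta>) * (1 + log_plus (norm (W \<theta>)))) \<partial>sphere_measure) < \<infinity>"
    using \<Omega>_fin nn_integral_surface_measure[OF W W_eq, of "\<lambda>z. ennreal (norm z * (1 + log_plus (norm z)))"] by simp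
  have k_Dini: "integrable lborel (\<lambda>s. indicator {0<..1} s * (norm (k s - h 0) / s))"
  proof (rule integrableI_nonneg)
    have "(\<integral>\<^sup>+s. ennreal (indicator {0<..1} s * (norm (k s - h 0) / s)) \<partial>lborel) =
        (\<integral>\<^sup>+t\<in>{0<..1}. ennreal (norm (h t - h 0) / t) \<partial>lebesgue)"
      unfolding nn_integral_completion
      by (rule nn_integral_cong_AE) (use k_eq in \<open>eventually_elim, auto simp: indicator_def\<close>)
    with Dini show "(\<integral>\<^sup>+s. ennreal (indicator {0<..1} s * (norm (k s - h 0) / s)) \<partial>lborel) < \<infinity>" by simp
  qed (auto simp: indicator_def)
  interpret rough_kernel W k "h 0" "\<lambda>y. f (x - y)" L R
  proof
    show "integrable sphere_measure W"
      by (rule L_log_L_integrable[OF W W_fin])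
    show "integrable sphere_measure (\<lambda>\<theta>. norm (W \<theta>) * ln (norm (W \<theta>)))"
      by (rule L_log_L_integrable_log[OF W W_fin])
    show "(\<integral>\<theta>. W \<theta> \<partial>sphere_measure) = 0"
      using integral_surface_measure[OF \<Omega>_meas W W_eq, of "\<lambda>z. z"] mean by simp
  qed (use k_int k_Dini LR in auto)

  obtain N where "N \<in> sets borel" "emeasure sphere_measure N = 0" and N: "\<And>\<theta>. \<theta> \<in> sphere 0 1 - N \<Longrightarrow> \<Omega> \<theta> = W \<theta>"
    using AE_sphere_measure[OF W_eq] by blast
  then have "AE y in lborel. sgn y \<notin> N" by (intro AE_lborel_sgn_notin)
  \<comment> \<open>Three null sets are discarded: the cone of bad directions, the spheres of bad
    radii, and the origin.\<close>
  then have rep: "AE y in lborel. y \<noteq> 0 \<and> \<Omega> y = W (sgn y) \<and> h (norm y) = k (norm y)"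
    using AE_lborel_norm[OF k_eq] AE_lborel_singleton[of "0::'a"]
  proof eventually_elim
    case (elim y)
    then show ?case
      using N[of "sgn y"] homogeneous_degree_0_sgn[OF hom, of y] by (simp add: norm_sgn)
  qed

  \<comment> \<open>The operator integrates in the variable of \<open>f\<close>, the locale in the
    difference variable; reflection through \<open>x\<close> preserves Lebesgue measure and links
    the two, as \<open>P \<epsilon> (x - y)\<close> contains \<open>f y\<close>.\<close>
  define P where "P \<epsilon> y = indicator {\<epsilon><..} (norm y) *\<^sub>R (K y * k (norm y) * f (x - y))" for \<epsilon> and y :: 'a
  have [measurable]: "P \<epsilon> \<in> borel_measurable borel" for \<epsilon>
    unfolding P_def by measurable
  have P_refl: "(\<lambda>y. P \<epsilon> (x - y)) \<in> borel_measurable borel" for \<epsilon> by measurable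
  have P_eq: "AE y in lborel. indicator {y. norm (x - y) > \<epsilon>} y *\<^sub>R kernel_integrand \<Omega> h f x y = P \<epsilon> (x - y)" for \<epsilon>
    using AE_lborel_reflect[OF rep, of x]
    by eventually_elim (auto simp: P_def K_def kernel_integrand_def indicator_def)
  have P_int: "integrable lborel (\<lambda>y. P \<epsilon> (x - y)) \<longleftrightarrow> integrable lborel (P \<epsilon>)" for \<epsilon>
    using integrable_distr_eq[of "\<lambda>y. x - y" lborel borel "P \<epsilon>"] by (simp add: lborel_distr_reflect)
  have P_integral: "(\<integral>y. P \<epsilon> (x - y) \<partial>lborel) = (\<integral>y. P \<epsilon> y \<partial>lborel)" for \<epsilon>
    using integral_distr[of "\<lambda>y. x - y" lborel borel "P \<epsilon>"] by (simp add: lborel_distr_reflect)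
  show ?A
    unfolding set_integrable_def integrable_lebesgue_cong_borel[OF P_refl P_eq] P_int
    unfolding P_def using integrable_truncated by blast
  have trunc: "truncated_op \<Omega> h \<epsilon> f x = (\<integral>y. P \<epsilon> y \<partial>lborel)" for \<epsilon>
    unfolding truncated_op_def set_lebesgue_integral_def
      integral_lebesgue_cong_borel[OF P_refl P_eq] P_integral ..
  have lim: "((\<lambda>\<epsilon>. truncated_op \<Omega> h \<epsilon> f x) \<longlongrightarrow> (\<integral>y. K y * G y \<partial>lborel)) (at_right 0)"
    unfolding trunc P_def by (rule tendsto_truncated)
  then have singular: "singular_op \<Omega> h f x = (\<integral>y. K y * G y \<partial>lborel)"
    unfolding singular_op_def by (intro tendsto_Lim) auto
  with lim show ?B by simp

  define Q where "Q t y = indicator {..t * \<omega> (sgn y)} (norm y) *\<^sub>R (k (norm y) * f (x - y) * sgn (W (sgn y)))" for t and y :: 'a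
  have Q: "Q t \<in> borel_measurable borel" for t
    using borel_measurable_integrable[OF integrable_average[of t]] unfolding Q_def by simp
  have Q_eq: "AE y in lborel. indicator ((*\<^sub>R) t ` star_set \<Omega>) y *\<^sub>R average_integrand \<Omega> h f x y = Q t y"
    if "t > 0" for t
    using rep
  proof eventually_elim
    case (elim y)
    then have "y \<in> (*\<^sub>R) t ` star_set \<Omega> \<longleftrightarrow> norm y \<le> t * \<omega> (sgn y)"
      using mem_scaled_star_set_iff[OF hom _ that, of y] by (simp add: \<omega>_def)
    with elim show ?case by (simp add: Q_def average_integrand_def indicator_def)
  qed
  show ?C
    unfolding set_integrable_def
    using integrable_lebesgue_cong_borel[OF Q Q_eq] integrable_average unfolding Q_def by blast
  have star: "star_average \<Omega> h t f x = average t" if "t > 0" for t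
    unfolding star_average_def average_def set_lebesgue_integral_def
      integral_lebesgue_cong_borel[OF Q Q_eq[OF that]] Q_def ..
  define a where "a t = indicator {0<..} t *\<^sub>R (average t / of_real t)" for t
  have a_int: "integrable lborel a"
    unfolding a_def by (rule integrable_average_div)
  then have a: "a \<in> borel_measurable borel" by (simp add: borel_measurable_integrable)
  have a_eq: "AE t in lborel. indicator {0<..} t *\<^sub>R (star_average \<Omega> h t f x / of_real t) = a t"
    by (rule AE_I2) (auto simp: a_def star indicator_def)
  show ?D
    unfolding set_integrable_def integrable_lebesgue_cong_borel[OF a a_eq] by (rule a_int)
  have log: "log_constant \<Omega> =
      1 / of_nat DIM('a) * (\<integral>\<theta>. W \<theta> * of_real (ln (norm (W \<theta>))) \<partial>sphere_measure)"
    unfolding log_constant_def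
    using integral_surface_measure[OF \<Omega>_meas W W_eq, of "\<lambda>z. z * of_real (ln (norm z))"] by simp
  \<comment> \<open>By \<open>integral_average_div\<close> the averages fall short of the principal
    value by exactly the logarithmic term, since the locale's \<open>c\<close> is \<open>h 0\<close>
    and its \<open>g 0\<close> is \<open>f x\<close>.\<close>
  show ?E
    unfolding set_lebesgue_integral_def integral_lebesgue_cong_borel[OF a a_eq] singular log
    using integral_average_div unfolding a_def by simp
qed

theorem theoremA2:
  fixes \<Omega> :: "real ^ 'n \<Rightarrow> complex" and h :: "real \<Rightarrow> complex"
  assumes "CARD('n) \<ge> 2"
    and "\<Omega> \<in> L_log_L_sphere"
    and "homogeneous_degree_0 \<Omega>"
    and "(\<integral>\<theta>. \<Omega> \<theta> \<partial>surface_measure) = 0"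
    and "h \<in> class_H1"
    and "(\<integral>\<^sup>+t\<in>{0<..1}. ennreal (norm (h t - h 0) / t) \<partial>lebesgue) < \<infinity>"
  shows "\<forall>f \<in> C1_compact_support. \<forall>x :: real ^ 'n.
           (\<forall>\<epsilon>>0. set_integrable lebesgue {y. norm (x - y) > \<epsilon>} (kernel_integrand \<Omega> h f x)) \<and>
           ((\<lambda>\<epsilon>. truncated_op \<Omega> h \<epsilon> f x) \<longlongrightarrow> singular_op \<Omega> h f x) (at_right 0) \<and>
           (\<forall>t>0. set_integrable lebesgue ((*\<^sub>R) t ` star_set \<Omega>) (average_integrand \<Omega> h f x)) \<and>
           set_integrable lebesgue {0<..} (\<lambda>t. star_average \<Omega> h t f x / of_real t) \<and>
           singular_op \<Omega> h f x =
             of_nat CARD('n) * (LINT t:{0<..}|lebesgue. star_average \<Omega> h t f x / of_real t)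
             + h 0 * log_constant \<Omega> * f x"
proof (intro ballI allI conjI impI)
  fix f :: "real ^ 'n \<Rightarrow> complex" and x :: "real ^ 'n"
  assume f: "f \<in> C1_compact_support"
  note facts = rough_singular_integral_eq[OF assms(2-6) f, of x]
  show "set_integrable lebesgue {y. norm (x - y) > \<epsilon>} (kernel_integrand \<Omega> h f x)" if "\<epsilon> > 0" for \<epsilon>
    using facts(1) that by blast
  show "((\<lambda>\<epsilon>. truncated_op \<Omega> h \<epsilon> f x) \<longlongrightarrow> singular_op \<Omega> h f x) (at_right 0)"
    by (rule facts(2))
  show "set_integrable lebesgue ((*\<^sub>R) t ` star_set \<Omega>) (average_integrand \<Omega> h f x)" if "t > 0" for t
    using facts(3) that by blast
  show "set_integrable lebesgue {0<..} (\<lambda>t. star_average \<Omega> h t f x / of_real t)"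
    by (rule facts(4))
  show "singular_op \<Omega> h f x =
      of_nat CARD('n) * (LINT t:{0<..}|lebesgue. star_average \<Omega> h t f x / of_real t)
      + h 0 * log_constant \<Omega> * f x"
    using facts(5) by simp
qed

end
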